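(* Let $\omega$ be a positive superharmonic weight on $\mathbb D$. Then the reproducing kernel $k^\omega$ of $\mathcal D(\omega)$ satisfies $$k^\omega(\cdot,z)=\mathcal R_\omega\, k^0(\cdot,z),\qquad z\in\mathbb D,$$ where $\mathcal R_\omega$ is the $1$-resolvent associated with $\mathcal E_\omega$.
   Context: $\mathbb D$ is the open unit disk, $\mathbb T$ the unit circle, $dA$ the normalized area measure on $\mathbb D$, $m$ the normalized Lebesgue measure on $\mathbb T$, and $L^2(\mathbb T)=L^2(\mathbb T,m)$. A superharmonic weight is a positive superharmonic function $\omega$ on $\mathbb D$ (the value $+\infty$ may be attained on a null set). For $f\in L^2(\mathbb T)$, $P[f]$ is its Poisson extension to $\mathbb D$. The gradient is normalized by $\nabla u=(\partial u,\bar\partial u)$, so $|\nabla u|^2=|\partial u|^2+|\bar\partial u|^2$. Put $\mathcal E_\omega(f,g)=\int_{\mathbb D}\nabla P[f]\cdot\overline{\nabla P[g]}\,\omega\,dA$ with domain $\mathcal D^h(\omega)=\{f\in L^2(\mathbb T):\mathcal E_\omega(f,f)<\infty\}$. $\mathcal D(\omega)$ is the space of holomorphic $f$ on $\mathbb D$ with $\mathcal D_\omega(f)=\int_{\mathbb D}|f'|^2\omega\,dA<\infty$. Standing assumption: $\mathcal D(\omega)\subset H^2$ (the Hardy space). Then $\mathcal D(\omega)$ with norm $\|f\|_\omega^2=\|f\|_{H^2}^2+\mathcal D_\omega(f)$ is a reproducing kernel Hilbert space with kernel $k^\omega$, i.e. $f(z)=\langle f,k^\omega(\cdot,z)\rangle_\omega$.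 $k^0(\zeta,z)=1/(1-\bar z\zeta)$ is the Szegő kernel. Elements of $H^2$ are identified with their boundary functions in $L^2(\mathbb T)$. $\mathcal G_\omega$ is the nonnegative self-adjoint operator on $L^2(\mathbb T)$ with $\mathcal E_\omega(f,g)=\langle\mathcal G_\omega f,g\rangle_{L^2(\mathbb T)}$ for $f\in\mathcal D(\mathcal G_\omega)$, $g\in\mathcal D^h(\omega)$, and $\mathcal R_\omega=(I+\mathcal G_\omega)^{-1}$. *)

theory Defs
  imports "HOL-Analysis.Analysis"
begin

abbreviation unit_disk :: "complex set" where
  "unit_disk \<equiv> ball 0 1"

(* Both measures live on the set itself (not on the whole plane), so that the values of
   a function off the circle, respectively off the disk, never matter, not even for
   measurability. *)

definition circle_measure :: "complex measure" where
  "circle_measure = distr (uniform_measure lborel {0..<2 * pi}) (restrict_space borel (sphere 0 1)) cis"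

definition area_measure :: "complex measure" where
  "area_measure = restrict_space (uniform_measure lborel unit_disk) unit_disk"


(* The second clause is lower semicontinuity; the last is the super-mean-value property.
   As usual, the constant +infinity is not superharmonic. *)

definition superharmonic_weight :: "(complex \<Rightarrow> ennreal) \<Rightarrow> bool" where
  "superharmonic_weight \<omega> \<longleftrightarrow>
     (\<forall>z\<in>unit_disk. 0 < \<omega> z) \<and>
     (\<forall>c. open {z \<in> unit_disk. c < \<omega> z}) \<and>
     (\<exists>z\<in>unit_disk. \<omega> z < \<infinity>) \<and>
     (\<forall>a r. 0 < r \<longrightarrow> cball a r \<subseteq> unit_disk \<longrightarrow>
        (\<integral>\<^sup>+\<zeta>. \<omega> (a + of_real r * \<zeta>) \<partial>circle_measure) \<le> \<omega> a)"


(* Elements of L^2 of the circle are represented by functions; two functions that agree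
   almost everywhere with respect to circle_measure stand for the same element. *)

definition L2_circle :: "(complex \<Rightarrow> complex) set" where
  "L2_circle = {f \<in> borel_measurable circle_measure. integrable circle_measure (\<lambda>\<zeta>. (norm (f \<zeta>))\<^sup>2)}"

definition L2_inner :: "(complex \<Rightarrow> complex) \<Rightarrow> (complex \<Rightarrow> complex) \<Rightarrow> complex" where
  "L2_inner f g = (LINT \<zeta>|circle_measure. f \<zeta> * cnj (g \<zeta>))"

definition L2_norm :: "(complex \<Rightarrow> complex) \<Rightarrow> real" where
  "L2_norm f = sqrt (LINT \<zeta>|circle_measure. (norm (f \<zeta>))\<^sup>2)"


definition poisson_ext :: "(complex \<Rightarrow> complex) \<Rightarrow> complex \<Rightarrow> complex" where
  "poisson_ext f z =
     (LINT \<zeta>|circle_measure. complex_of_real ((1 - (norm z)\<^sup>2) / (norm (\<zeta> - z))\<^sup>2) * f \<zeta>)"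

(* Wirtinger derivatives (u_x - i u_y) / 2 and (u_x + i u_y) / 2; frechet_derivative is the
   real-linear derivative. *)

definition d_z :: "(complex \<Rightarrow> complex) \<Rightarrow> complex \<Rightarrow> complex" where
  "d_z u z = (frechet_derivative u (at z) 1 - \<i> * frechet_derivative u (at z) \<i>) / 2"

definition d_zbar :: "(complex \<Rightarrow> complex) \<Rightarrow> complex \<Rightarrow> complex" where
  "d_zbar u z = (frechet_derivative u (at z) 1 + \<i> * frechet_derivative u (at z) \<i>) / 2"

definition harmonic_dirichlet_space :: "(complex \<Rightarrow> ennreal) \<Rightarrow> (complex \<Rightarrow> complex) set" where
  "harmonic_dirichlet_space \<omega> =
     {f \<in> L2_circle.
        (\<integral>\<^sup>+z. ennreal ((norm (d_z (poisson_ext f) z))\<^sup>2 + (norm (d_zbar (poisson_ext f) z))\<^sup>2) * \<omega> z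
           \<partial>area_measure) < \<infinity>}"

(* A superharmonic weight is finite almost everywhere, so passing to enn2real (which sends
   infinity to 0) in the Bochner integrals below changes nothing. *)

definition energy_form ::
  "(complex \<Rightarrow> ennreal) \<Rightarrow> (complex \<Rightarrow> complex) \<Rightarrow> (complex \<Rightarrow> complex) \<Rightarrow> complex" where
  "energy_form \<omega> f g =
     (LINT z|area_measure.
        (d_z (poisson_ext f) z * cnj (d_z (poisson_ext g) z) +
         d_zbar (poisson_ext f) z * cnj (d_zbar (poisson_ext g) z)) * complex_of_real (enn2real (\<omega> z)))"


definition hardy_space :: "(complex \<Rightarrow> complex) set" where
  "hardy_space =
     {f. f holomorphic_on unit_disk \<and>
         bdd_above ((\<lambda>r. LINT \<zeta>|circle_measure. (norm (f (of_real r * \<zeta>)))\<^sup>2) ` {0..<1})}"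

definition boundary_fun :: "(complex \<Rightarrow> complex) \<Rightarrow> complex \<Rightarrow> complex" where
  "boundary_fun f \<zeta> = Lim (at_left (1::real)) (\<lambda>r. f (of_real r * \<zeta>))"

definition dirichlet_space :: "(complex \<Rightarrow> ennreal) \<Rightarrow> (complex \<Rightarrow> complex) set" where
  "dirichlet_space \<omega> =
     {f. f holomorphic_on unit_disk \<and>
         (\<integral>\<^sup>+z. ennreal ((norm (deriv f z))\<^sup>2) * \<omega> z \<partial>area_measure) < \<infinity>}"

(* The inner product whose norm is the square root of the squared Hardy norm plus the
   weighted Dirichlet integral. *)

definition dirichlet_inner ::
  "(complex \<Rightarrow> ennreal) \<Rightarrow> (complex \<Rightarrow> complex) \<Rightarrow> (complex \<Rightarrow> complex) \<Rightarrow> complex" where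
  "dirichlet_inner \<omega> f g =
     L2_inner (boundary_fun f) (boundary_fun g) +
     (LINT z|area_measure. deriv f z * cnj (deriv g z) * complex_of_real (enn2real (\<omega> z)))"

definition reproducing_kernel :: "(complex \<Rightarrow> ennreal) \<Rightarrow> (complex \<Rightarrow> complex \<Rightarrow> complex) \<Rightarrow> bool" where
  "reproducing_kernel \<omega> k \<longleftrightarrow>
     (\<forall>z\<in>unit_disk. (\<lambda>\<zeta>. k \<zeta> z) \<in> dirichlet_space \<omega> \<and>
        (\<forall>f\<in>dirichlet_space \<omega>. f z = dirichlet_inner \<omega> f (\<lambda>\<zeta>. k \<zeta> z)))"

definition szego_kernel :: "complex \<Rightarrow> complex \<Rightarrow> complex" where
  "szego_kernel \<zeta> z = 1 / (1 - cnj z * \<zeta>)"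


(* Unbounded operators on L^2 of the circle are given by their graphs, which are required
   to be saturated under equality almost everywhere: (f, h) \<in> G says that f is in the
   domain of G and that G f = h almost everywhere. *)

type_synonym L2_graph = "((complex \<Rightarrow> complex) \<times> (complex \<Rightarrow> complex)) set"

definition L2_eq :: "(complex \<Rightarrow> complex) \<Rightarrow> (complex \<Rightarrow> complex) \<Rightarrow> bool" where
  "L2_eq f g \<longleftrightarrow> (AE \<zeta> in circle_measure. f \<zeta> = g \<zeta>)"

definition L2_operator :: "L2_graph \<Rightarrow> bool" where
  "L2_operator G \<longleftrightarrow>
     G \<subseteq> L2_circle \<times> L2_circle \<and>
     (\<forall>(f, h)\<in>G. \<forall>f'\<in>L2_circle. \<forall>h'\<in>L2_circle. L2_eq f f' \<longrightarrow> L2_eq h h' \<longrightarrow> (f', h') \<in> G) \<and>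
     (\<forall>f h h'. (f, h) \<in> G \<longrightarrow> (f, h') \<in> G \<longrightarrow> L2_eq h h') \<and>
     ((\<lambda>_. 0), (\<lambda>_. 0)) \<in> G \<and>
     (\<forall>(f, h)\<in>G. \<forall>(f', h')\<in>G. \<forall>c.
        ((\<lambda>\<zeta>. c * f \<zeta> + f' \<zeta>), (\<lambda>\<zeta>. c * h \<zeta> + h' \<zeta>)) \<in> G)"

definition densely_defined :: "L2_graph \<Rightarrow> bool" where
  "densely_defined G \<longleftrightarrow>
     (\<forall>f\<in>L2_circle. \<forall>e>0. \<exists>u\<in>Domain G. L2_norm (\<lambda>\<zeta>. f \<zeta> - u \<zeta>) < e)"

definition adjoint_graph :: "L2_graph \<Rightarrow> L2_graph" where
  "adjoint_graph G =
     {(f, h) \<in> L2_circle \<times> L2_circle. \<forall>(u, v)\<in>G. L2_inner v f = L2_inner u h}"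

definition self_adjoint_operator :: "L2_graph \<Rightarrow> bool" where
  "self_adjoint_operator G \<longleftrightarrow> L2_operator G \<and> densely_defined G \<and> adjoint_graph G = G"

definition nonneg_operator :: "L2_graph \<Rightarrow> bool" where
  "nonneg_operator G \<longleftrightarrow> (\<forall>(f, h)\<in>G. L2_inner h f \<in> \<real>\<^sub>\<ge>\<^sub>0)"

definition associated_operator :: "(complex \<Rightarrow> ennreal) \<Rightarrow> L2_graph \<Rightarrow> bool" where
  "associated_operator \<omega> G \<longleftrightarrow>
     self_adjoint_operator G \<and> nonneg_operator G \<and>
     Domain G \<subseteq> harmonic_dirichlet_space \<omega> \<and>
     (\<forall>(f, h)\<in>G. \<forall>g\<in>harmonic_dirichlet_space \<omega>. energy_form \<omega> f g = L2_inner h g)"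

definition id_plus :: "L2_graph \<Rightarrow> L2_graph" where
  "id_plus G = {(u, f). f \<in> L2_circle \<and> (\<exists>h. (u, h) \<in> G \<and> L2_eq f (\<lambda>\<zeta>. u \<zeta> + h \<zeta>))}"

definition resolvent :: "L2_graph \<Rightarrow> L2_graph" where
  "resolvent G = (id_plus G)\<inverse>"

end

theory Submission
  imports Defs "HOL-Complex_Analysis.Cauchy_Integral_Formula"
begin

text \<open>
  Write \<open>\<kappa>\<close> for the boundary function of \<open>k(\<cdot>, z)\<close> and \<open>S\<close> for the Szego kernel at \<open>z\<close>. The claim
  is that \<open>\<kappa>\<close> lies in the domain of \<open>G\<close> and \<open>G \<kappa> = S - \<kappa>\<close>. Since \<open>G\<close> equals its adjoint, this
  says that \<open>\<langle>G u, \<kappa>\<rangle> = \<langle>u, S - \<kappa>\<rangle>\<close> for every \<open>u\<close> in the domain of \<open>G\<close>. The left side is the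
  energy of \<open>u\<close> and \<open>\<kappa>\<close>. The Poisson extension of \<open>u\<close> splits as \<open>f + cnj h\<close> with \<open>f\<close> and \<open>h\<close>
  holomorphic, where \<open>f\<close> is the Szego projection of \<open>u\<close>, and the Poisson extension of \<open>\<kappa>\<close> is the
  holomorphic function \<open>k(\<cdot>, z)\<close>; hence the antiholomorphic part of \<open>u\<close> drops out, and the energy is the
  weighted Dirichlet inner product of \<open>f\<close> and \<open>k(\<cdot>, z)\<close>. As \<open>f\<close> has finite weighted Dirichlet
  integral, the reproducing property turns this into \<open>f(z) - \<langle>f*, \<kappa>\<rangle>\<close>, where \<open>f*\<close> is the boundary
  function of \<open>f\<close>. Finally \<open>f(z) = \<langle>u, S\<rangle>\<close>, because \<open>f\<close> is the Szego projection, and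
  \<open>\<langle>f*, \<kappa>\<rangle> = \<langle>u, \<kappa>\<rangle>\<close>, because \<open>u\<close> and \<open>f*\<close> have the same Fourier coefficients of nonnegative index.

  The analytic content is Fatou's theorem for the Hardy space: a function in \<open>H\<^sup>2\<close> has radial limits
  almost everywhere, these form an \<open>L\<^sup>2\<close> function, and its Poisson extension is the original function
  (\<open>radial_limit_AE\<close>, \<open>hardy_boundary_fun\<close>). Almost everywhere convergence comes from a weak-type
  maximal inequality for Poisson integrals of nonnegative functions (\<open>maximal_poisson\<close>). The operators
  sending \<open>g\<close> to the function \<open>\<zeta> \<mapsto> P[g](r \<zeta>)\<close> form a semigroup of positive operators that preserve
  constants and integrals, so Hopf's maximal ergodic lemma controls their averages
  (\<open>hopf_maximal_poisson\<close>), and Harnack's inequality bounds \<open>P[g]\<close> at a single radius by such an average.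
  The \<open>L\<^sup>2\<close> statements then follow from Parseval's identity and Fatou's lemma for integrals.
\<close>

section \<open>Normalized Lebesgue measure on the circle\<close>

lemma space_circle [simp]: "space circle_measure = sphere 0 1"
  by (simp add: circle_measure_def space_restrict_space)

lemma sets_circle: "sets circle_measure = sets (restrict_space borel (sphere 0 1))"
  by (simp add: circle_measure_def)

lemma measurable_circle_continuous:
  fixes f :: "complex \<Rightarrow> 'b::topological_space"
  assumes "continuous_on (sphere 0 1) f"
  shows "f \<in> borel_measurable circle_measure"
  using borel_measurable_continuous_on_restrict[OF assms] measurable_cong_sets[OF sets_circle refl]
  by blast

lemma measurable_cis: "cis \<in> measurable (uniform_measure lborel {0..<2 * pi}) (restrict_space borel (sphere 0 1))"
proof -
  have "cis \<in> borel_measurable borel"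
    by (intro borel_measurable_continuous_onI continuous_intros)
  then show ?thesis
    by (intro measurable_restrict_space2) (auto simp: uniform_measure_def)
qed

lemma uniform_measure_eq_density:
  "uniform_measure lborel {0..<2 * pi} = density lborel (\<lambda>t. ennreal (indicator {0..<2 * pi} t / (2 * pi)))"
  unfolding uniform_measure_def
  by (intro density_cong) (auto simp: indicator_def divide_ennreal ennreal_1[symmetric] simp del: ennreal_1)

lemma emeasure_circle: "emeasure circle_measure (sphere 0 1) = 1"
proof -
  have "emeasure circle_measure (sphere 0 1) =
      emeasure (uniform_measure lborel {0..<2 * pi}) (cis -` sphere 0 1 \<inter> space (uniform_measure lborel {0..<2 * pi}))"
    unfolding circle_measure_def
    by (rule emeasure_distr[OF measurable_cis]) (use sets.top[of "restrict_space borel (sphere (0::complex) 1)"] in \<open>simp add: space_restrict_space\<close>)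
  also have "cis -` sphere 0 1 \<inter> space (uniform_measure lborel {0..<2 * pi}) = UNIV"
    by auto
  also have "emeasure (uniform_measure lborel {0..<2 * pi}) UNIV = 1"
    by (subst emeasure_uniform_measure) (auto simp: ennreal_divide_self)
  finally show ?thesis .
qed

interpretation circle: finite_measure circle_measure
  by standard (simp add: emeasure_circle)

lemma measure_circle [simp]: "measure circle_measure (sphere 0 1) = 1"
  by (simp add: measure_def emeasure_circle)

text \<open>
  All orthogonality relations on the circle reduce to this one integral, which the fundamental theorem of
  calculus evaluates after parametrizing the circle by \<open>cis\<close>.
\<close>

lemma circle_integral_power:
  assumes "n > 0"
  shows "(LINT \<zeta>|circle_measure. \<zeta> ^ n) = 0"
proof -
  have m1 [measurable]: "(\<lambda>t. cis t ^ n) \<in> borel_measurable borel"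
    by (intro borel_measurable_continuous_onI continuous_intros)
  have m2: "(\<lambda>\<zeta>::complex. \<zeta> ^ n) \<in> borel_measurable (restrict_space borel (sphere 0 1))"
    by (intro measurable_restrict_space1 borel_measurable_continuous_onI continuous_intros)
  have "(LINT \<zeta>|circle_measure. \<zeta> ^ n) = (LINT t|uniform_measure lborel {0..<2 * pi}. cis t ^ n)"
    unfolding circle_measure_def
    by (rule integral_distr[OF measurable_cis m2])
  also have "\<dots> = (LINT t|lborel. (indicator {0..<2 * pi} t / (2 * pi)) *\<^sub>R cis t ^ n)"
    unfolding uniform_measure_eq_density
    by (rule integral_density) auto
  also have "\<dots> = (LINT t|lborel. (1 / (2 * pi)) *\<^sub>R (indicator {0..2 * pi} t *\<^sub>R cis t ^ n))"
  proof (rule integral_cong_AE)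
    have "AE t in lborel. t \<noteq> 2 * pi" by (rule AE_lborel_singleton)
    then show "AE t in lborel. (indicator {0..<2 * pi} t / (2 * pi)) *\<^sub>R cis t ^ n =
        (1 / (2 * pi)) *\<^sub>R (indicator {0..2 * pi} t *\<^sub>R cis t ^ n)"
      by eventually_elim (auto simp: indicator_def)
  qed measurable
  also have "\<dots> = (1 / (2 * pi)) *\<^sub>R (LINT t|lborel. indicator {0..2 * pi} t *\<^sub>R cis t ^ n)"
    by (rule integral_scaleR_right) 
  also have "(LINT t|lborel. indicator {0..2 * pi} t *\<^sub>R cis t ^ n) =
      cis (2 * pi) ^ n / (\<i> * n) - cis 0 ^ n / (\<i> * n)"
  proof (rule integral_FTC_Icc)
    fix t :: real
    show "((\<lambda>t. cis t ^ n / (\<i> * n)) has_vector_derivative cis t ^ n) (at t within {0..2 * pi})"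
    proof -
      have "((\<lambda>t. exp (\<i> * n * of_real t) / (\<i> * n)) has_vector_derivative exp (\<i> * n * of_real t)) (at t within {0..2 * pi})"
        using assms
        by (intro has_vector_derivative_real_field) (auto intro!: derivative_eq_intros simp: field_simps)
      moreover have "cis s ^ n = exp (\<i> * n * of_real s)" for s
        by (simp only: Complex.DeMoivre) (simp add: cis_conv_exp mult_ac)
      ultimately show ?thesis by simp
    qed
  qed (auto intro!: continuous_intros)
  finally show ?thesis by simp
qed

section \<open>Fourier coefficients and absolutely convergent power series\<close>

lemma circle_integrable_mult_continuous:
  fixes \<phi> f :: "complex \<Rightarrow> complex"
  assumes "integrable circle_measure \<phi>" and f: "continuous_on (sphere 0 1) f"
  shows "integrable circle_measure (\<lambda>\<zeta>. \<phi> \<zeta> * f \<zeta>)"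
proof -
  have "compact (f ` sphere 0 1)"
    by (intro compact_continuous_image f compact_sphere)
  then obtain B where B: "\<And>\<zeta>. \<zeta> \<in> sphere 0 1 \<Longrightarrow> norm (f \<zeta>) \<le> B"
    by (meson bounded_iff compact_imp_bounded image_eqI)
  show ?thesis
  proof (rule Bochner_Integration.integrable_bound)
    show "integrable circle_measure (\<lambda>\<zeta>. B *\<^sub>R \<phi> \<zeta>)"
      using assms by auto
    show "(\<lambda>\<zeta>. \<phi> \<zeta> * f \<zeta>) \<in> borel_measurable circle_measure"
      using assms(1) measurable_circle_continuous[OF f] by (intro borel_measurable_times) auto
    have "0 \<le> B" using B[of 1] order_trans[OF norm_ge_zero, of "f 1" B] by simp
    show "AE \<zeta> in circle_measure. norm (\<phi> \<zeta> * f \<zeta>) \<le> norm (B *\<^sub>R \<phi> \<zeta>)"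
      using \<open>0 \<le> B\<close> B by (intro AE_I2) (auto simp: norm_mult mult.commute[of B] intro!: mult_left_mono)
  qed
qed

lemma circle_integrable_continuous:
  fixes f :: "complex \<Rightarrow> 'b::{banach, second_countable_topology}"
  assumes f: "continuous_on (sphere 0 1) f"
  shows "integrable circle_measure f"
proof -
  have "compact (f ` sphere 0 1)"
    by (intro compact_continuous_image f compact_sphere)
  then obtain B where "\<And>\<zeta>. \<zeta> \<in> sphere 0 1 \<Longrightarrow> norm (f \<zeta>) \<le> B"
    by (meson bounded_iff compact_imp_bounded image_eqI)
  then show ?thesis
    by (intro circle.integrable_const_bound[of _ B] measurable_circle_continuous f AE_I2) auto
qed

lemma circle_integral_cnj:
  "(LINT \<zeta>|circle_measure. cnj (f \<zeta>)) = cnj (LINT \<zeta>|circle_measure. f \<zeta>)"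
  by simp

text \<open>
  Only the coefficients of nonnegative index are used: the others are conjugates of the coefficients of
  the conjugate function.
\<close>

definition fourier_coeff :: "(complex \<Rightarrow> complex) \<Rightarrow> nat \<Rightarrow> complex" where
  "fourier_coeff \<phi> n = (LINT \<zeta>|circle_measure. \<phi> \<zeta> * cnj (\<zeta> ^ n))"

lemma cnj_circle: "\<zeta> * cnj \<zeta> = 1" if "\<zeta> \<in> sphere 0 1"
  using that complex_norm_square[of \<zeta>] by simp

lemma fourier_coeff_monomial: "fourier_coeff (\<lambda>\<zeta>. \<zeta> ^ m) n = (if m = n then 1 else 0)"
proof -
  have *: "(LINT \<zeta>|circle_measure. \<zeta> ^ (k + l) * cnj (\<zeta> ^ l)) = (LINT \<zeta>|circle_measure. \<zeta> ^ k)" for k l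
  proof (rule Bochner_Integration.integral_cong[OF refl])
    fix \<zeta> assume "\<zeta> \<in> space circle_measure"
    then have "\<zeta> ^ l * cnj \<zeta> ^ l = 1" by (simp add: cnj_circle flip: power_mult_distrib)
    then show "\<zeta> ^ (k + l) * cnj (\<zeta> ^ l) = \<zeta> ^ k"
      by (simp add: power_add mult.assoc)
  qed
  show ?thesis
  proof (cases "n \<le> m")
    case True
    define k where "k = m - n"
    with True have k: "m = k + n" by simp
    show ?thesis
    proof (cases "k = 0")
      case True
      then show ?thesis using *[of 0 n] by (simp add: k fourier_coeff_def)
    next
      case False
      then show ?thesis using *[of k n] circle_integral_power[of k] by (simp add: k fourier_coeff_def)
    qed
  next
    case False
    define k where "k = n - m"
    with False have k: "n = k + m" "k > 0" by simp_all
    have "fourier_coeff (\<lambda>\<zeta>. \<zeta> ^ m) n = (LINT \<zeta>|circle_measure. cnj (\<zeta> ^ n * cnj (\<zeta> ^ m)))"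
      by (simp add: fourier_coeff_def mult.commute)
    also have "\<dots> = cnj (LINT \<zeta>|circle_measure. \<zeta> ^ n * cnj (\<zeta> ^ m))"
      by (rule circle_integral_cnj)
    finally show ?thesis using *[of k m] circle_integral_power[of k] False k by simp
  qed
qed

lemma fourier_coeff_cnj_monomial:
  assumes "m > 0"
  shows "fourier_coeff (\<lambda>\<zeta>. cnj (\<zeta> ^ m)) n = 0"
proof -
  have "fourier_coeff (\<lambda>\<zeta>. cnj (\<zeta> ^ m)) n = (LINT \<zeta>|circle_measure. cnj (\<zeta> ^ (m + n)))"
    by (simp add: fourier_coeff_def power_add)
  also have "\<dots> = cnj (LINT \<zeta>|circle_measure. \<zeta> ^ (m + n))"
    by (rule circle_integral_cnj)
  finally show ?thesis using assms circle_integral_power[of "m + n"] by simp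
qed

definition power_series :: "(nat \<Rightarrow> complex) \<Rightarrow> complex \<Rightarrow> complex" where
  "power_series c z = (\<Sum>n. c n * z ^ n)"

lemma power_series_summable_norm:
  fixes c :: "nat \<Rightarrow> complex"
  assumes "summable (\<lambda>n. norm (c n))" "norm z \<le> 1"
  shows "summable (\<lambda>n. norm (c n * z ^ n))"
proof (rule summable_comparison_test'[OF assms(1), of 0])
  fix n
  have "norm z ^ n \<le> 1" using assms(2) by (simp add: power_le_one)
  then show "norm (norm (c n * z ^ n)) \<le> norm (c n)"
    by (simp add: norm_mult norm_power mult_left_le)
qed

lemma continuous_power_series:
  assumes c: "summable (\<lambda>n. norm (c n))"
  shows "continuous_on (cball 0 1) (power_series c)"
proof -
  have "uniform_limit (cball 0 1) (\<lambda>n x. \<Sum>i<n. c i * x ^ i) (\<lambda>x. \<Sum>i. c i * x ^ i) sequentially"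
  proof (rule Weierstrass_m_test[OF _ c])
    fix n and x :: complex assume "x \<in> cball 0 1"
    then have "norm x ^ n \<le> 1" by (simp add: power_le_one)
    then show "norm (c n * x ^ n) \<le> norm (c n)"
      by (simp add: norm_mult norm_power mult_left_le)
  qed
  then show ?thesis
    unfolding power_series_def[abs_def]
    by (rule uniform_limit_theorem[rotated]) (simp_all add: continuous_intros)
qed

text \<open>
  Absolute convergence of the coefficients makes the series converge uniformly on the circle, so it may be
  integrated term by term. Parseval's identity, the Szego projection and the Poisson formula are all
  special cases.
\<close>

lemma inner_power_series:
  assumes \<phi>: "integrable circle_measure \<phi>" and c: "summable (\<lambda>n. norm (c n))"
  shows "(\<lambda>n. fourier_coeff \<phi> n * cnj (c n)) sums (LINT \<zeta>|circle_measure. \<phi> \<zeta> * cnj (power_series c \<zeta>))"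
proof -
  have int: "integrable circle_measure (\<lambda>\<zeta>. \<phi> \<zeta> * cnj (c n * \<zeta> ^ n))" for n
    by (rule circle_integrable_mult_continuous[OF \<phi>]) (auto intro!: continuous_on_cnj continuous_on_mult continuous_on_power)
  have norm_eq: "norm (\<phi> \<zeta> * cnj (c n * \<zeta> ^ n)) = norm (c n) * norm (\<phi> \<zeta>)"
    if "\<zeta> \<in> sphere 0 1" for n \<zeta>
    using that by (simp add: norm_mult norm_power)
  have "(\<lambda>n. LINT \<zeta>|circle_measure. \<phi> \<zeta> * cnj (c n * \<zeta> ^ n)) sums
        (LINT \<zeta>|circle_measure. (\<Sum>n. \<phi> \<zeta> * cnj (c n * \<zeta> ^ n)))"
  proof (rule sums_integral[OF int])
    show "AE \<zeta> in circle_measure. summable (\<lambda>n. norm (\<phi> \<zeta> * cnj (c n * \<zeta> ^ n)))"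
    proof (rule AE_I2)
      fix \<zeta> assume "\<zeta> \<in> space circle_measure"
      then show "summable (\<lambda>n. norm (\<phi> \<zeta> * cnj (c n * \<zeta> ^ n)))"
        by (subst norm_eq) (simp_all add: c summable_mult2)
    qed
    have "(LINT \<zeta>|circle_measure. norm (\<phi> \<zeta> * cnj (c n * \<zeta> ^ n))) =
          norm (c n) * (LINT \<zeta>|circle_measure. norm (\<phi> \<zeta>))" for n
    proof -
      have "(LINT \<zeta>|circle_measure. norm (\<phi> \<zeta> * cnj (c n * \<zeta> ^ n))) =
          (LINT \<zeta>|circle_measure. norm (c n) * norm (\<phi> \<zeta>))"
        by (rule Bochner_Integration.integral_cong[OF refl]) (rule norm_eq, simp)
      then show ?thesis by simp
    qed
    then show "summable (\<lambda>n. LINT \<zeta>|circle_measure. norm (\<phi> \<zeta> * cnj (c n * \<zeta> ^ n)))"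
      using summable_mult2[OF c] by (simp only:)
  qed
  moreover have "(LINT \<zeta>|circle_measure. \<phi> \<zeta> * cnj (c n * \<zeta> ^ n)) = fourier_coeff \<phi> n * cnj (c n)" for n
  proof -
    have "(LINT \<zeta>|circle_measure. \<phi> \<zeta> * cnj (c n * \<zeta> ^ n)) =
        (LINT \<zeta>|circle_measure. (\<phi> \<zeta> * cnj (\<zeta> ^ n)) * cnj (c n))"
      by (rule Bochner_Integration.integral_cong[OF refl]) simp
    then show ?thesis unfolding fourier_coeff_def by simp
  qed
  moreover have "(LINT \<zeta>|circle_measure. (\<Sum>n. \<phi> \<zeta> * cnj (c n * \<zeta> ^ n))) =
      (LINT \<zeta>|circle_measure. \<phi> \<zeta> * cnj (power_series c \<zeta>))"
  proof (rule Bochner_Integration.integral_cong[OF refl])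
    fix \<zeta> assume "\<zeta> \<in> space circle_measure"
    then have "summable (\<lambda>n. norm (c n * \<zeta> ^ n))"
      using power_series_summable_norm[OF c, of \<zeta>] by simp
    then have "summable (\<lambda>n. c n * \<zeta> ^ n)"
      by (rule summable_norm_cancel)
    then have "(\<lambda>n. \<phi> \<zeta> * cnj (c n * \<zeta> ^ n)) sums (\<phi> \<zeta> * cnj (power_series c \<zeta>))"
      unfolding power_series_def
      by (intro sums_mult) (simp only: sums_cnj summable_sums)
    then show "(\<Sum>n. \<phi> \<zeta> * cnj (c n * \<zeta> ^ n)) = \<phi> \<zeta> * cnj (power_series c \<zeta>)"
      by (simp add: sums_iff)
  qed
  ultimately show ?thesis by simp
qed

lemma circle_integrable_power_series:
  assumes "summable (\<lambda>n. norm (c n))"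
  shows "integrable circle_measure (power_series c)"
  by (intro circle_integrable_continuous continuous_on_subset[OF continuous_power_series[OF assms]]) auto

lemma fourier_coeff_power_series:
  assumes "summable (\<lambda>n. norm (c n))"
  shows "fourier_coeff (power_series c) n = c n"
proof -
  have "(\<lambda>m. fourier_coeff (\<lambda>\<zeta>. \<zeta> ^ n) m * cnj (c m)) sums
      (LINT \<zeta>|circle_measure. \<zeta> ^ n * cnj (power_series c \<zeta>))"
    by (intro inner_power_series assms(1) circle_integrable_continuous continuous_on_cnj continuous_on_power continuous_on_id)
  moreover have "(\<lambda>m. fourier_coeff (\<lambda>\<zeta>. \<zeta> ^ n) m * cnj (c m)) sums cnj (c n)"
  proof -
    have "fourier_coeff (\<lambda>\<zeta>. \<zeta> ^ n) m * cnj (c m) = (if m = n then cnj (c m) else 0)" for m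
      unfolding fourier_coeff_monomial by auto
    then show ?thesis using sums_single[of n "\<lambda>m. cnj (c m)"] by simp
  qed
  ultimately have "(LINT \<zeta>|circle_measure. \<zeta> ^ n * cnj (power_series c \<zeta>)) = cnj (c n)"
    using sums_unique2 by blast
  then have "cnj (LINT \<zeta>|circle_measure. \<zeta> ^ n * cnj (power_series c \<zeta>)) = c n" by simp
  then show ?thesis
    unfolding fourier_coeff_def circle_integral_cnj[symmetric] by (simp del: Bochner_Integration.integral_cnj add: mult.commute)
qed

text \<open>
  The Fourier coefficients of negative index of a power series vanish.
\<close>

lemma integral_power_series_monomial:
  assumes "summable (\<lambda>n. norm (c n))" "n > 0"
  shows "(LINT \<zeta>|circle_measure. power_series c \<zeta> * \<zeta> ^ n) = 0"
proof -
  have "(\<lambda>m. fourier_coeff (\<lambda>\<zeta>. cnj (\<zeta> ^ n)) m * cnj (c m)) sums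
      (LINT \<zeta>|circle_measure. cnj (\<zeta> ^ n) * cnj (power_series c \<zeta>))"
    by (intro inner_power_series assms(1) circle_integrable_continuous continuous_on_cnj continuous_on_power continuous_on_id)
  then have "(LINT \<zeta>|circle_measure. cnj (\<zeta> ^ n) * cnj (power_series c \<zeta>)) = 0"
    unfolding fourier_coeff_cnj_monomial[OF assms(2)] by (simp add: sums_iff)
  then have "cnj (LINT \<zeta>|circle_measure. cnj (\<zeta> ^ n) * cnj (power_series c \<zeta>)) = 0" by simp
  then show ?thesis
    unfolding circle_integral_cnj[symmetric] by (simp del: Bochner_Integration.integral_cnj add: mult.commute)
qed

lemma parseval_power_series:
  assumes c: "summable (\<lambda>n. norm (c n))"
  shows "(\<lambda>n. (norm (c n))\<^sup>2) sums (LINT \<zeta>|circle_measure. (norm (power_series c \<zeta>))\<^sup>2)"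
proof -
  have eq: "x * cnj x = complex_of_real ((norm x)\<^sup>2)" for x
    by (simp only: complex_norm_square)
  have "(\<lambda>n. complex_of_real ((norm (c n))\<^sup>2)) sums
      (LINT \<zeta>|circle_measure. complex_of_real ((norm (power_series c \<zeta>))\<^sup>2))"
    using inner_power_series[OF circle_integrable_power_series[OF c] c]
    unfolding fourier_coeff_power_series[OF c] eq .
  from sums_Re[OF this] show ?thesis by (simp only: integral_complex_of_real Re_complex_of_real)
qed

section \<open>Szego and Poisson kernels\<close>

lemma szego_kernel_power_series:
  assumes "norm z < 1" "norm \<zeta> \<le> 1"
  shows "szego_kernel \<zeta> z = power_series (\<lambda>n. cnj z ^ n) \<zeta>"
proof -
  have "norm (cnj z * \<zeta>) < 1"
    using assms by (simp add: norm_mult) (meson le_less_trans mult_left_le norm_ge_zero)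
  from geometric_sums[OF this] show ?thesis
    by (simp add: power_series_def szego_kernel_def power_mult_distrib sums_iff)
qed

lemma summable_szego:
  assumes "norm z < 1"
  shows "summable (\<lambda>n. norm (cnj z ^ n))"
  using assms by (simp add: norm_power summable_geometric)

text \<open>
  Integration against the Szego kernel at \<open>z\<close> is evaluation at \<open>z\<close> of the analytic projection, for an
  arbitrary integrable function.
\<close>

lemma szego_projection_sums:
  assumes \<phi>: "integrable circle_measure \<phi>" and z: "norm z < 1"
  shows "(\<lambda>n. fourier_coeff \<phi> n * z ^ n) sums (LINT \<zeta>|circle_measure. \<phi> \<zeta> * cnj (szego_kernel \<zeta> z))"
proof -
  have "(LINT \<zeta>|circle_measure. \<phi> \<zeta> * cnj (szego_kernel \<zeta> z)) =
        (LINT \<zeta>|circle_measure. \<phi> \<zeta> * cnj (power_series (\<lambda>n. cnj z ^ n) \<zeta>))"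
    by (rule Bochner_Integration.integral_cong[OF refl]) (use z in \<open>simp add: szego_kernel_power_series\<close>)
  then show ?thesis
    using inner_power_series[OF \<phi> summable_szego[OF z]] by simp
qed

lemma szego_projection:
  assumes \<phi>: "integrable circle_measure \<phi>" and z: "norm z < 1"
  shows "L2_inner \<phi> (\<lambda>\<zeta>. szego_kernel \<zeta> z) = power_series (fourier_coeff \<phi>) z"
  using szego_projection_sums[OF assms] by (simp add: power_series_def L2_inner_def sums_iff)

text \<open>
  Convergence at one point between \<open>r\<close> and \<open>1\<close> forces absolute convergence at \<open>r\<close>; the dilated
  series is then covered by the results on absolutely summable coefficients.
\<close>

lemma power_series_summable_disk:
  fixes c :: "nat \<Rightarrow> complex"
  assumes "\<And>z. norm z < 1 \<Longrightarrow> summable (\<lambda>n. c n * z ^ n)" and "0 \<le> r" "r < 1"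
  shows "summable (\<lambda>n. norm (c n * of_real r ^ n))"
proof -
  define s where "s = (r + 1) / 2"
  have s: "r < s" "s < 1" "0 < s" using assms(2,3) by (auto simp: s_def)
  have "summable (\<lambda>n. c n * of_real s ^ n)" by (rule assms(1)) (use s in simp)
  from powser_insidea[OF this, of "of_real r"] show ?thesis using s assms by simp
qed

definition poisson_kernel :: "complex \<Rightarrow> complex \<Rightarrow> real" where
  "poisson_kernel z \<zeta> = (1 - (norm z)\<^sup>2) / (norm (\<zeta> - z))\<^sup>2"

lemma poisson_ext_kernel:
  "poisson_ext \<phi> z = (LINT \<zeta>|circle_measure. of_real (poisson_kernel z \<zeta>) * \<phi> \<zeta>)"
  by (simp add: poisson_ext_def poisson_kernel_def)

lemma poisson_kernel_nonneg: "norm z < 1 \<Longrightarrow> 0 \<le> poisson_kernel z \<zeta>"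
  by (simp add: poisson_kernel_def power_le_one)

text \<open>
  With \<open>a = 1 - cnj z * \<zeta>\<close>, which satisfies \<open>norm a = norm (\<zeta> - z)\<close> on the circle, both sides
  equal \<open>(a + cnj a - a * cnj a) / (a * cnj a)\<close>. This decomposes the Poisson extension into a holomorphic
  and an antiholomorphic part.
\<close>

lemma poisson_kernel_szego:
  assumes z: "norm z < 1" and \<zeta>: "\<zeta> \<in> sphere 0 1"
  shows "of_real (poisson_kernel z \<zeta>) = cnj (szego_kernel \<zeta> z) + szego_kernel \<zeta> z - 1"
proof -
  define a where "a = 1 - cnj z * \<zeta>"
  have *: "\<zeta> * cnj \<zeta> = 1" using cnj_circle[OF \<zeta>] .
  have "\<zeta> * cnj a = \<zeta> - z"
    using * by (simp add: a_def algebra_simps)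
  then have "norm (\<zeta> - z) = norm a" using \<zeta> by (metis norm_mult complex_mod_cnj mem_sphere_0 mult_1)
  then have n: "of_real ((norm (\<zeta> - z))\<^sup>2) = a * cnj a" by (simp only: complex_norm_square)
  have "a \<noteq> 0"
  proof
    assume "a = 0"
    then have "norm (cnj z * \<zeta>) = 1" by (simp add: a_def)
    then show False using z \<zeta> by (simp add: norm_mult)
  qed
  have sz: "szego_kernel \<zeta> z = 1 / a" by (simp add: szego_kernel_def a_def)
  have "cnj (szego_kernel \<zeta> z) + szego_kernel \<zeta> z - 1 = (a + cnj a - a * cnj a) / (a * cnj a)"
    unfolding sz using \<open>a \<noteq> 0\<close> by (simp add: field_simps)
  also have "a + cnj a - a * cnj a = 1 - z * cnj z"
  proof -
    have "a + cnj a - a * cnj a = 1 - z * cnj z * (\<zeta> * cnj \<zeta>)" by (simp add: a_def algebra_simps)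
    then show ?thesis by (simp add: *)
  qed
  also have "\<dots> = of_real (1 - (norm z)\<^sup>2)"
    by (simp only: complex_norm_square of_real_diff of_real_1)
  finally show ?thesis
    unfolding poisson_kernel_def of_real_divide n by simp
qed

lemma continuous_szego: "norm z < 1 \<Longrightarrow> continuous_on (sphere 0 1) (\<lambda>\<zeta>. szego_kernel \<zeta> z)"
  using continuous_on_subset[OF continuous_power_series[OF summable_szego], of z "sphere 0 1"]
  by (rule continuous_on_eq) (auto simp: szego_kernel_power_series)

lemma continuous_poisson_kernel:
  assumes "norm z < 1" shows "continuous_on (sphere 0 1) (poisson_kernel z)"
proof -
  have "norm (\<zeta> - z) \<noteq> 0" if "norm \<zeta> = 1" for \<zeta>
    using assms that by auto
  then show ?thesis
    unfolding poisson_kernel_def[abs_def] by (intro continuous_intros) auto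
qed

lemma poisson_ext_szego:
  assumes \<phi>: "integrable circle_measure \<phi>" and z: "norm z < 1"
  shows "poisson_ext \<phi> z = power_series (fourier_coeff \<phi>) z
      + cnj (power_series (fourier_coeff (\<lambda>\<zeta>. cnj (\<phi> \<zeta>))) z) - fourier_coeff \<phi> 0"
proof -
  note sk = continuous_szego[OF z]
  have i1: "integrable circle_measure (\<lambda>\<zeta>. \<phi> \<zeta> * cnj (szego_kernel \<zeta> z))"
    by (rule circle_integrable_mult_continuous[OF \<phi> continuous_on_cnj[OF sk]])
  have i2: "integrable circle_measure (\<lambda>\<zeta>. \<phi> \<zeta> * szego_kernel \<zeta> z)"
    by (rule circle_integrable_mult_continuous[OF \<phi> sk])
  have "poisson_ext \<phi> z = (LINT \<zeta>|circle_measure. \<phi> \<zeta> * cnj (szego_kernel \<zeta> z) + \<phi> \<zeta> * szego_kernel \<zeta> z - \<phi> \<zeta>)"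
    unfolding poisson_ext_kernel
    by (rule Bochner_Integration.integral_cong[OF refl]) (use z in \<open>simp add: poisson_kernel_szego algebra_simps\<close>)
  also have "\<dots> = (LINT \<zeta>|circle_measure. \<phi> \<zeta> * cnj (szego_kernel \<zeta> z)) +
      (LINT \<zeta>|circle_measure. \<phi> \<zeta> * szego_kernel \<zeta> z) - (LINT \<zeta>|circle_measure. \<phi> \<zeta>)"
    using i1 i2 \<phi> by simp
  also have "(LINT \<zeta>|circle_measure. \<phi> \<zeta> * szego_kernel \<zeta> z) =
      cnj (L2_inner (\<lambda>\<zeta>. cnj (\<phi> \<zeta>)) (\<lambda>\<zeta>. szego_kernel \<zeta> z))"
    unfolding L2_inner_def circle_integral_cnj[symmetric] by (simp del: Bochner_Integration.integral_cnj)
  also have "(LINT \<zeta>|circle_measure. \<phi> \<zeta>) = fourier_coeff \<phi> 0"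
    by (simp add: fourier_coeff_def)
  finally show ?thesis
    using szego_projection[OF \<phi> z] szego_projection[of "\<lambda>\<zeta>. cnj (\<phi> \<zeta>)" z] \<phi> z
    by (simp add: L2_inner_def)
qed

lemma power_series_only_const:
  assumes "\<And>n. n > 0 \<Longrightarrow> c n = 0"
  shows "power_series c z = c 0"
proof -
  have "(\<lambda>n. c n * z ^ n) sums (c 0 * z ^ 0)"
    using sums_finite[of "{0}" "\<lambda>n. c n * z ^ n"] assms by auto
  then show ?thesis by (simp add: power_series_def sums_iff)
qed

text \<open>
  When the Fourier coefficients of negative index vanish, the antiholomorphic part of the Poisson extension
  is just the constant that \<open>poisson_ext_szego\<close> subtracts again.
\<close>

lemma poisson_ext_analytic:
  assumes \<phi>: "integrable circle_measure \<phi>" and z: "norm z < 1"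
    and 0: "\<And>n. n > 0 \<Longrightarrow> (LINT \<zeta>|circle_measure. \<phi> \<zeta> * \<zeta> ^ n) = 0"
  shows "poisson_ext \<phi> z = power_series (fourier_coeff \<phi>) z"
proof -
  have c: "fourier_coeff (\<lambda>\<zeta>. cnj (\<phi> \<zeta>)) n = cnj (LINT \<zeta>|circle_measure. \<phi> \<zeta> * \<zeta> ^ n)" for n
    unfolding fourier_coeff_def circle_integral_cnj[symmetric] by (simp del: Bochner_Integration.integral_cnj)
  have "power_series (fourier_coeff (\<lambda>\<zeta>. cnj (\<phi> \<zeta>))) z = fourier_coeff (\<lambda>\<zeta>. cnj (\<phi> \<zeta>)) 0"
    by (rule power_series_only_const) (simp add: c 0)
  also have "\<dots> = cnj (fourier_coeff \<phi> 0)"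
    unfolding c by (simp add: fourier_coeff_def)
  finally show ?thesis unfolding poisson_ext_szego[OF \<phi> z] by simp
qed

lemma poisson_ext_power_series:
  assumes c: "summable (\<lambda>n. norm (c n))" and z: "norm z < 1"
  shows "poisson_ext (power_series c) z = power_series c z"
proof -
  have "fourier_coeff (power_series c) = c" using fourier_coeff_power_series[OF c] by auto
  then show ?thesis
    using poisson_ext_analytic[OF circle_integrable_power_series[OF c] z]
      integral_power_series_monomial[OF c] by simp
qed

lemma poisson_ext_const:
  assumes "norm z < 1" shows "poisson_ext (\<lambda>_. a) z = a"
proof -
  have s: "summable (\<lambda>n. norm (if n = 0 then a else 0))"
    by (rule summable_finite[of "{0}"]) auto
  have "power_series (\<lambda>n. if n = 0 then a else 0) = (\<lambda>_. a)"
    by (rule ext, subst power_series_only_const) auto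
  then show ?thesis using poisson_ext_power_series[OF s assms] by simp
qed

lemma circle_integrable_poisson:
  fixes \<phi> :: "complex \<Rightarrow> complex"
  assumes "integrable circle_measure \<phi>" "norm z < 1"
  shows "integrable circle_measure (\<lambda>\<zeta>. of_real (poisson_kernel z \<zeta>) * \<phi> \<zeta>)"
proof -
  have "continuous_on (sphere 0 1) (\<lambda>\<zeta>. complex_of_real (poisson_kernel z \<zeta>))"
    by (intro continuous_on_of_real continuous_poisson_kernel assms)
  from circle_integrable_mult_continuous[OF assms(1) this] show ?thesis by (simp add: mult.commute)
qed

text \<open>
  The Poisson extension on real-valued functions, where positivity and monotonicity make sense.
\<close>

definition poisson_integral :: "(complex \<Rightarrow> real) \<Rightarrow> complex \<Rightarrow> real" where
  "poisson_integral g z = (LINT \<zeta>|circle_measure. poisson_kernel z \<zeta> * g \<zeta>)"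

lemma poisson_ext_of_real: "poisson_ext (\<lambda>\<zeta>. of_real (g \<zeta>)) z = of_real (poisson_integral g z)"
  unfolding poisson_ext_kernel poisson_integral_def by (simp flip: of_real_mult)

lemma poisson_integrable:
  fixes g :: "complex \<Rightarrow> real"
  assumes "integrable circle_measure g" "norm z < 1"
  shows "integrable circle_measure (\<lambda>\<zeta>. poisson_kernel z \<zeta> * g \<zeta>)"
proof -
  have "integrable circle_measure (\<lambda>\<zeta>. complex_of_real (g \<zeta>))" using assms(1) by simp
  from integrable_Re[OF circle_integrable_poisson[OF this assms(2)]] show ?thesis by simp
qed

lemma poisson_integral_const: "norm z < 1 \<Longrightarrow> poisson_integral (\<lambda>_. a) z = a"
  using poisson_ext_const[of z "of_real a"] poisson_ext_of_real[of "\<lambda>_. a" z] by simp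

lemma poisson_integral_Re:
  assumes "integrable circle_measure \<phi>" "norm z < 1"
  shows "poisson_integral (\<lambda>\<zeta>. Re (\<phi> \<zeta>)) z = Re (poisson_ext \<phi> z)"
proof -
  have "Re (poisson_ext \<phi> z) = (LINT \<zeta>|circle_measure. Re (of_real (poisson_kernel z \<zeta>) * \<phi> \<zeta>))"
    unfolding poisson_ext_kernel by (rule integral_Re[OF circle_integrable_poisson[OF assms], symmetric])
  then show ?thesis by (simp add: poisson_integral_def)
qed

lemma poisson_integral_mono:
  assumes "integrable circle_measure g" "integrable circle_measure h" "norm z < 1"
    and "\<And>\<zeta>. \<zeta> \<in> sphere 0 1 \<Longrightarrow> g \<zeta> \<le> h \<zeta>"
  shows "poisson_integral g z \<le> poisson_integral h z"
  unfolding poisson_integral_def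
  by (intro integral_mono poisson_integrable assms mult_left_mono poisson_kernel_nonneg) (use assms in auto)

text \<open>
  This is Jensen's inequality for the probability density \<open>poisson_kernel z\<close>: expand
  \<open>0 \<le> P[\<bar>F - w\<bar>\<^sup>2](z)\<close> at \<open>w = F z = P[F](z)\<close>. It gives a harmonic majorant of the
  square of an analytic function.
\<close>

lemma norm_power_series_poisson:
  assumes c: "summable (\<lambda>n. norm (c n))" and z: "norm z < 1"
  shows "(norm (power_series c z))\<^sup>2 \<le> poisson_integral (\<lambda>\<zeta>. (norm (power_series c \<zeta>))\<^sup>2) z"
proof -
  let ?F = "power_series c"
  define w where "w = ?F z"
  note cF = continuous_on_subset[OF continuous_power_series[OF c], of "sphere 0 1"]
  have iF: "integrable circle_measure (\<lambda>\<zeta>. Re (cnj w * ?F \<zeta>))"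
    by (intro integrable_Re integrable_mult_right circle_integrable_power_series c)
  have iF2: "integrable circle_measure (\<lambda>\<zeta>. (norm (?F \<zeta>))\<^sup>2)"
    by (intro circle_integrable_continuous continuous_on_power continuous_on_norm cF) auto
  \<comment> \<open>the lower bound is what remains of the square after discarding the nonnegative term\<close>
  have "poisson_integral (\<lambda>\<zeta>. 2 * Re (cnj w * ?F \<zeta>) - (norm w)\<^sup>2) z \<le> poisson_integral (\<lambda>\<zeta>. (norm (?F \<zeta>))\<^sup>2) z"
  proof (rule poisson_integral_mono[OF _ iF2 z])
    fix \<zeta>
    have "0 \<le> (norm (?F \<zeta> - w))\<^sup>2" by simp
    also have "\<dots> = (norm (?F \<zeta>))\<^sup>2 - 2 * Re (cnj w * ?F \<zeta>) + (norm w)\<^sup>2"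
      by (simp add: cmod_power2) (simp add: power2_eq_square algebra_simps)
    finally show "2 * Re (cnj w * ?F \<zeta>) - (norm w)\<^sup>2 \<le> (norm (?F \<zeta>))\<^sup>2" by simp
  qed (intro Bochner_Integration.integrable_diff integrable_mult_right iF circle.integrable_const)
  moreover have "poisson_integral (\<lambda>\<zeta>. 2 * Re (cnj w * ?F \<zeta>) - (norm w)\<^sup>2) z = (norm w)\<^sup>2"
  proof -
    let ?\<phi> = "\<lambda>\<zeta>. 2 * (cnj w * ?F \<zeta>) - of_real ((norm w)\<^sup>2)"
    have i: "integrable circle_measure ?\<phi>"
      using circle_integrable_power_series[OF c] by simp
    have "poisson_ext ?\<phi> z = (LINT \<zeta>|circle_measure. (2 * cnj w) * (of_real (poisson_kernel z \<zeta>) * ?F \<zeta>) -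
        of_real (poisson_kernel z \<zeta>) * of_real ((norm w)\<^sup>2))"
      unfolding poisson_ext_kernel by (simp add: algebra_simps)
    also have "\<dots> = 2 * cnj w * poisson_ext ?F z - poisson_ext (\<lambda>_. of_real ((norm w)\<^sup>2)) z"
      unfolding poisson_ext_kernel
      by (subst Bochner_Integration.integral_diff)
        (use circle_integrable_poisson[OF circle_integrable_power_series[OF c] z] circle_integrable_poisson[of "\<lambda>_. of_real ((norm w)\<^sup>2)", OF _ z] in auto)
    also have "\<dots> = of_real ((norm w)\<^sup>2)"
      unfolding poisson_ext_power_series[OF c z] poisson_ext_const[OF z] w_def[symmetric] complex_norm_square
      by simp
    finally show ?thesis
      using poisson_integral_Re[OF i z] by simp
  qed
  ultimately show ?thesis by (simp add: w_def)
qed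

text \<open>
  A real Poisson integral is the real part of a holomorphic function. The dilation, semigroup and mean
  value properties of Poisson integrals are read off from this power series.
\<close>

lemma poisson_integral_power_series:
  assumes "integrable circle_measure g"
  shows "\<exists>h. (\<forall>z. norm z < 1 \<longrightarrow> summable (\<lambda>n. h n * z ^ n)) \<and>
    (\<forall>z. norm z < 1 \<longrightarrow> poisson_integral g z = Re (power_series h z)) \<and>
    Re (h 0) = (LINT \<zeta>|circle_measure. g \<zeta>)"
proof -
  define G where "G = (\<lambda>\<zeta>. complex_of_real (g \<zeta>))"
  have G: "integrable circle_measure G" using assms by (simp add: G_def)
  \<comment> \<open>the analytic part counted twice, with the constant term counted once, since the coefficients of a real
    function at opposite indices are conjugate\<close>
  let ?h = "\<lambda>n. 2 * fourier_coeff G n - (if n = 0 then fourier_coeff G 0 else 0)"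
  have s: "(\<lambda>n. ?h n * z ^ n) sums (2 * power_series (fourier_coeff G) z - fourier_coeff G 0)" if "norm z < 1" for z
  proof -
    have "(\<lambda>n. fourier_coeff G n * z ^ n) sums power_series (fourier_coeff G) z"
      using szego_projection_sums[OF G that] by (simp add: sums_iff power_series_def)
    from sums_diff[OF sums_mult[OF this, of 2] sums_single[of 0 "\<lambda>_. fourier_coeff G 0"]]
    have "(\<lambda>n. 2 * (fourier_coeff G n * z ^ n) - (if n = 0 then fourier_coeff G 0 else 0)) sums
        (2 * power_series (fourier_coeff G) z - fourier_coeff G 0)" .
    then show ?thesis
      by (rule sums_cong[THEN iffD1, rotated]) (auto simp: algebra_simps)
  qed
  have "summable (\<lambda>n. ?h n * z ^ n)" if "norm z < 1" for z
    using s[OF that] by (simp add: sums_iff)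
  moreover have "poisson_integral g z = Re (power_series ?h z)" if "norm z < 1" for z
  proof -
    have "power_series ?h z = 2 * power_series (fourier_coeff G) z - fourier_coeff G 0"
      using s[OF that] by (simp add: sums_iff power_series_def)
    moreover have "of_real (poisson_integral g z) = power_series (fourier_coeff G) z + cnj (power_series (fourier_coeff G) z) - fourier_coeff G 0"
      using poisson_ext_szego[OF G that] poisson_ext_of_real[of g z] by (simp add: G_def)
    from arg_cong[OF this, of Re] have "poisson_integral g z = 2 * Re (power_series (fourier_coeff G) z) - Re (fourier_coeff G 0)"
      by simp
    ultimately show ?thesis by simp
  qed
  moreover have "Re (?h 0) = (LINT \<zeta>|circle_measure. g \<zeta>)"
    by (simp add: fourier_coeff_def G_def)
  ultimately show ?thesis by (intro exI[of _ ?h]) blast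
qed

lemma poisson_integral_cong:
  "(\<And>\<zeta>. \<zeta> \<in> sphere 0 1 \<Longrightarrow> g \<zeta> = h \<zeta>) \<Longrightarrow> poisson_integral g z = poisson_integral h z"
  unfolding poisson_integral_def by (rule Bochner_Integration.integral_cong[OF refl]) simp

lemma poisson_integral_dilation:
  assumes g: "integrable circle_measure g" and s: "0 \<le> s" "s < 1"
  shows "\<exists>c. summable (\<lambda>n. norm (c n)) \<and>
    (\<forall>\<xi>. norm \<xi> \<le> 1 \<longrightarrow> poisson_integral g (of_real s * \<xi>) = Re (power_series c \<xi>)) \<and>
    Re (c 0) = (LINT \<zeta>|circle_measure. g \<zeta>)"
proof -
  obtain h where h: "\<And>z. norm z < 1 \<Longrightarrow> summable (\<lambda>n. h n * z ^ n)"
    "\<And>z. norm z < 1 \<Longrightarrow> poisson_integral g z = Re (power_series h z)"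
    "Re (h 0) = (LINT \<zeta>|circle_measure. g \<zeta>)"
    using poisson_integral_power_series[OF g] by blast
  show ?thesis
  proof (intro exI[of _ "\<lambda>n. h n * of_real s ^ n"] conjI allI impI)
    show "summable (\<lambda>n. norm (h n * of_real s ^ n))"
      by (rule power_series_summable_disk[OF h(1) s])
    fix \<xi> :: complex assume "norm \<xi> \<le> 1"
    then have "norm (of_real s * \<xi>) < 1"
      using s mult_left_le[of "norm \<xi>" s] by (simp add: norm_mult)
    from h(2)[OF this] show "poisson_integral g (of_real s * \<xi>) = Re (power_series (\<lambda>n. h n * of_real s ^ n) \<xi>)"
      by (simp add: power_series_def power_mult_distrib mult.assoc)
  qed (use h in simp)
qed

text \<open>
  The dilated Poisson integral is the real part of an absolutely convergent power series, and the Poisson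
  extension reproduces such series.
\<close>

lemma poisson_integral_semigroup:
  assumes g: "integrable circle_measure g" and s: "0 \<le> s" "s < 1" and z: "norm z < 1"
  shows "poisson_integral (\<lambda>\<xi>. poisson_integral g (of_real s * \<xi>)) z = poisson_integral g (of_real s * z)"
proof -
  obtain c where c: "summable (\<lambda>n. norm (c n))"
    "\<And>\<xi>. norm \<xi> \<le> 1 \<Longrightarrow> poisson_integral g (of_real s * \<xi>) = Re (power_series c \<xi>)"
    "Re (c 0) = (LINT \<zeta>|circle_measure. g \<zeta>)"
    using poisson_integral_dilation[OF g s] by blast
  have "poisson_integral (\<lambda>\<xi>. poisson_integral g (of_real s * \<xi>)) z = poisson_integral (\<lambda>\<xi>. Re (power_series c \<xi>)) z"
    by (rule poisson_integral_cong) (simp add: c)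
  also have "\<dots> = Re (power_series c z)"
    using poisson_integral_Re[OF circle_integrable_power_series z] poisson_ext_power_series z c(1) by simp
  finally show ?thesis using c(2)[of z] z by simp
qed

text \<open>
  Passing from \<open>g\<close> to its Poisson integral on a smaller circle does not change the integral; this is the
  mean value property, since both integrals are the value of the harmonic function at the origin.
\<close>

lemma poisson_integral_mean:
  assumes g: "integrable circle_measure g" and s: "0 \<le> s" "s < 1"
  shows "(LINT \<zeta>|circle_measure. poisson_integral g (of_real s * \<zeta>)) = (LINT \<zeta>|circle_measure. g \<zeta>)"
proof -
  obtain c where c: "summable (\<lambda>n. norm (c n))"
    "\<And>\<xi>. norm \<xi> \<le> 1 \<Longrightarrow> poisson_integral g (of_real s * \<xi>) = Re (power_series c \<xi>)"
    "Re (c 0) = (LINT \<zeta>|circle_measure. g \<zeta>)"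
    using poisson_integral_dilation[OF g s] by blast
  have "(LINT \<zeta>|circle_measure. poisson_integral g (of_real s * \<zeta>)) = (LINT \<zeta>|circle_measure. Re (power_series c \<zeta>))"
    by (rule Bochner_Integration.integral_cong[OF refl]) (simp add: c)
  also have "\<dots> = Re (LINT \<zeta>|circle_measure. power_series c \<zeta>)"
    by (rule integral_Re[OF circle_integrable_power_series[OF c(1)]])
  also have "(LINT \<zeta>|circle_measure. power_series c \<zeta>) = c 0"
    using fourier_coeff_power_series[OF c(1), of 0] by (simp add: fourier_coeff_def)
  finally show ?thesis using c(3) by simp
qed

lemma continuous_poisson_integral:
  assumes g: "integrable circle_measure g" and s: "0 \<le> s" "s < 1"
  shows "continuous_on (cball 0 1) (\<lambda>\<xi>. poisson_integral g (of_real s * \<xi>))"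
proof -
  obtain c where c: "summable (\<lambda>n. norm (c n))"
    "\<And>\<xi>. norm \<xi> \<le> 1 \<Longrightarrow> poisson_integral g (of_real s * \<xi>) = Re (power_series c \<xi>)"
    "Re (c 0) = (LINT \<zeta>|circle_measure. g \<zeta>)"
    using poisson_integral_dilation[OF g s] by blast
  show ?thesis
    by (rule continuous_on_eq[OF continuous_on_Re[OF continuous_power_series[OF c(1)]]]) (simp add: c)
qed

text \<open>
  Harnack's inequality along a radius, with an explicit constant. Since
  \<open>\<rho> - \<rho>' \<le> 1 - \<rho>' \<le> norm (\<xi> - \<rho>' \<zeta>)\<close>, the distance from \<open>\<xi>\<close> to \<open>\<rho> \<zeta>\<close> is at most twice that
  to \<open>\<rho>' \<zeta>\<close>, which costs a factor \<open>4\<close>; the numerators \<open>1 - \<rho>\<^sup>2\<close> and \<open>1 - \<rho>'\<^sup>2\<close> cost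
  another factor \<open>2\<close> because \<open>\<rho>\<^sup>2 \<le> \<rho>'\<close>.
\<close>

lemma poisson_kernel_harnack:
  assumes \<rho>: "0 \<le> \<rho>" "\<rho> < 1" "\<rho>\<^sup>2 \<le> \<rho>'" "\<rho>' \<le> \<rho>" and "norm \<zeta> = 1" "norm \<xi> = 1"
  shows "poisson_kernel (of_real \<rho>' * \<zeta>) \<xi> \<le> 8 * poisson_kernel (of_real \<rho> * \<zeta>) \<xi>"
proof -
  define a where "a = norm (\<xi> - of_real \<rho>' * \<zeta>)"
  define b where "b = norm (\<xi> - of_real \<rho> * \<zeta>)"
  have \<rho>': "0 \<le> \<rho>'" "\<rho>' < 1" using assms zero_le_power2[of \<rho>] by linarith+
  have a: "1 - \<rho>' \<le> a"
    using norm_triangle_ineq2[of \<xi> "of_real \<rho>' * \<zeta>"] assms \<rho>' by (simp add: a_def norm_mult)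
  have "1 - \<rho> \<le> b"
    using norm_triangle_ineq2[of \<xi> "of_real \<rho> * \<zeta>"] assms by (simp add: b_def norm_mult)
  then have b0: "0 < b" using \<rho> by linarith
  have "b = norm ((\<xi> - of_real \<rho>' * \<zeta>) - of_real (\<rho> - \<rho>') * \<zeta>)"
    by (simp add: b_def algebra_simps)
  also have "\<dots> \<le> a + norm (of_real (\<rho> - \<rho>') * \<zeta>)"
    unfolding a_def by (rule norm_triangle_ineq4)
  also have "norm (of_real (\<rho> - \<rho>') * \<zeta>) = \<rho> - \<rho>'"
    using assms by (simp only: norm_mult norm_of_real) simp
  finally have b: "b \<le> 2 * a" using a assms by simp
  have a0: "0 < a" using a \<rho>' by linarith
  have "1 - \<rho>'\<^sup>2 = (1 - \<rho>') * (1 + \<rho>')" by (simp add: power2_eq_square algebra_simps)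
  also have "\<dots> \<le> (1 - \<rho>\<^sup>2) * 2" using \<rho> \<rho>' by (intro mult_mono) auto
  finally have n: "1 - \<rho>'\<^sup>2 \<le> 2 * (1 - \<rho>\<^sup>2)" by simp
  have "b\<^sup>2 \<le> (2 * a)\<^sup>2" using b b0 by (intro power_mono) auto
  then have b2: "b\<^sup>2 \<le> 4 * a\<^sup>2" by (simp add: power_mult_distrib)
  have "0 \<le> 1 - \<rho>\<^sup>2" using \<rho> by (simp add: power_le_one)
  have "(1 - \<rho>'\<^sup>2) / a\<^sup>2 \<le> 2 * (1 - \<rho>\<^sup>2) / a\<^sup>2" using n a0 by (intro divide_right_mono) auto
  also have "\<dots> = 8 * (1 - \<rho>\<^sup>2) / (4 * a\<^sup>2)" using a0 by (simp add: field_simps)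
  also have "\<dots> \<le> 8 * (1 - \<rho>\<^sup>2) / b\<^sup>2"
    using b2 b0 a0 \<open>0 \<le> 1 - \<rho>\<^sup>2\<close> by (intro divide_left_mono) auto
  finally show ?thesis
    using assms \<rho>' by (simp add: poisson_kernel_def a_def b_def norm_mult)
qed

lemma poisson_integral_harnack:
  assumes g: "integrable circle_measure g" "\<And>\<zeta>. \<zeta> \<in> sphere 0 1 \<Longrightarrow> 0 \<le> g \<zeta>"
    and \<rho>: "0 \<le> \<rho>" "\<rho> < 1" "\<rho>\<^sup>2 \<le> \<rho>'" "\<rho>' \<le> \<rho>" and \<zeta>: "norm \<zeta> = 1"
  shows "poisson_integral g (of_real \<rho>' * \<zeta>) \<le> 8 * poisson_integral g (of_real \<rho> * \<zeta>)"
proof -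
  have \<rho>': "0 \<le> \<rho>'" "\<rho>' < 1" using \<rho> zero_le_power2[of \<rho>] by linarith+
  have n: "norm (of_real \<rho>' * \<zeta>) < 1" "norm (of_real \<rho> * \<zeta>) < 1"
    using \<zeta> \<rho> \<rho>' by (simp_all add: norm_mult)
  have "poisson_integral g (of_real \<rho>' * \<zeta>) \<le> (LINT \<xi>|circle_measure. 8 * (poisson_kernel (of_real \<rho> * \<zeta>) \<xi> * g \<xi>))"
    unfolding poisson_integral_def
  proof (rule integral_mono)
    fix \<xi> assume "\<xi> \<in> space circle_measure"
    then have "norm \<xi> = 1" "0 \<le> g \<xi>" using g(2) by auto
    from mult_right_mono[OF poisson_kernel_harnack[OF \<rho> \<zeta> this(1)] this(2)]
    show "poisson_kernel (of_real \<rho>' * \<zeta>) \<xi> * g \<xi> \<le> 8 * (poisson_kernel (of_real \<rho> * \<zeta>) \<xi> * g \<xi>)"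
      by simp
  qed (use poisson_integrable[OF g(1)] n in auto)
  then show ?thesis by (simp add: poisson_integral_def)
qed

lemma poisson_integral_nonneg:
  assumes "integrable circle_measure g" "\<And>\<zeta>. \<zeta> \<in> sphere 0 1 \<Longrightarrow> 0 \<le> g \<zeta>" "norm z < 1"
  shows "0 \<le> poisson_integral g z"
  unfolding poisson_integral_def
  by (rule integral_nonneg_AE) (use assms in \<open>auto intro!: AE_I2 mult_nonneg_nonneg poisson_kernel_nonneg\<close>)

lemma poisson_integral_diff:
  assumes "integrable circle_measure g" "integrable circle_measure h" "norm z < 1"
  shows "poisson_integral (\<lambda>\<zeta>. g \<zeta> - h \<zeta>) z = poisson_integral g z - poisson_integral h z"
  unfolding poisson_integral_def
  by (simp add: right_diff_distrib poisson_integrable assms)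

lemma poisson_integral_add:
  assumes "integrable circle_measure g" "integrable circle_measure h" "norm z < 1"
  shows "poisson_integral (\<lambda>\<zeta>. g \<zeta> + h \<zeta>) z = poisson_integral g z + poisson_integral h z"
  unfolding poisson_integral_def
  by (simp add: distrib_left poisson_integrable assms)

section \<open>Maximal inequality for Poisson integrals\<close>

text \<open>
  Hopf's maximal ergodic lemma for the operator \<open>Q f \<zeta> = P[f](r \<zeta>)\<close>, which is positive, fixes
  constants and preserves integrals. With \<open>u\<^sub>0 = Q g\<close>, let \<open>V\<^sub>n\<close> be the iterates of
  \<open>f \<mapsto> max 0 (u\<^sub>0 - \<alpha> + Q f)\<close> starting at \<open>0\<close>. They increase, and they dominate the sums of the
  first \<open>n\<close> functions \<open>Q\<^sup>j u\<^sub>0 - \<alpha>\<close>, because those sums satisfy the same recursion without the maximum.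
  On the set \<open>E\<close> where \<open>V\<^sub>n\<close> is positive, \<open>V\<^sub>n \<le> u\<^sub>0 - \<alpha> + Q V\<^sub>n\<close>. Integrating, the terms \<open>V\<^sub>n\<close> and
  \<open>Q V\<^sub>n\<close> cancel, and what remains is \<open>\<alpha> * measure E \<le> \<integral> g\<close>.
\<close>

lemma hopf_maximal_poisson:
  fixes g :: "complex \<Rightarrow> real" and r \<alpha> :: real
  assumes g: "integrable circle_measure g" "\<And>\<zeta>. \<zeta> \<in> sphere 0 1 \<Longrightarrow> 0 \<le> g \<zeta>"
    and r: "0 < r" "r < 1" and \<alpha>: "0 < \<alpha>"
  shows "\<exists>A\<in>sets circle_measure. measure circle_measure A \<le> (LINT \<zeta>|circle_measure. g \<zeta>) / \<alpha> \<and>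
    (\<forall>\<zeta>\<in>sphere 0 1. \<forall>n. real n * \<alpha> < (\<Sum>j<n. poisson_integral g (of_real (r ^ Suc j) * \<zeta>)) \<longrightarrow> \<zeta> \<in> A)"
proof -
  define u where "u j \<zeta> = poisson_integral g (of_real (r ^ Suc j) * \<zeta>)" for j \<zeta>
  define Q where "Q f \<zeta> = poisson_integral f (of_real r * \<zeta>)" for f \<zeta>
  define V where "V = rec_nat (\<lambda>_. 0) (\<lambda>_ f \<zeta>. max 0 (u 0 \<zeta> - \<alpha> + Q f \<zeta>))"
  have V0: "V 0 = (\<lambda>_. 0)" and VS: "V (Suc n) = (\<lambda>\<zeta>. max 0 (u 0 \<zeta> - \<alpha> + Q (V n) \<zeta>))" for n
    by (simp_all add: V_def)
  have rp: "0 \<le> r ^ Suc j" "r ^ Suc j < 1" for j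
    using r power_Suc_less_one[of r j] by auto
  have rs: "norm (of_real r * \<zeta>) < 1" if "\<zeta> \<in> sphere 0 1" for \<zeta> :: complex
    using that r by (simp add: norm_mult)
  have u_cont: "continuous_on (sphere 0 1) (u j)" for j
    using continuous_on_subset[OF continuous_poisson_integral[OF g(1) rp], of "sphere 0 1" j]
    by (auto simp: u_def[abs_def])
  have Q_cont: "continuous_on (sphere 0 1) (Q f)" if "integrable circle_measure f" for f
    using continuous_on_subset[OF continuous_poisson_integral[OF that, of r], of "sphere 0 1"] r
    by (auto simp: Q_def[abs_def])
  have V_cont: "continuous_on (sphere 0 1) (V n)" for n
  proof (induction n)
    case (Suc n)
    show ?case unfolding VS
      by (intro continuous_on_max continuous_on_add continuous_on_diff continuous_on_const u_cont Q_cont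
          circle_integrable_continuous Suc)
  qed (simp add: V0)
  note V_int = circle_integrable_continuous[OF V_cont]
  note u_int = circle_integrable_continuous[OF u_cont]
  have V_nonneg: "0 \<le> V n \<zeta>" for n \<zeta> by (cases n) (simp_all add: V0 VS)
  have V_mono: "V n \<zeta> \<le> V (Suc n) \<zeta>" if "\<zeta> \<in> sphere 0 1" for n \<zeta>
    using that
  proof (induction n arbitrary: \<zeta>)
    case (Suc n)
    have "Q (V n) \<zeta> \<le> Q (V (Suc n)) \<zeta>"
      unfolding Q_def by (rule poisson_integral_mono[OF V_int V_int rs[OF Suc.prems]]) (rule Suc.IH)
    then show ?case unfolding VS[of "Suc n"] VS[of n] by simp
  qed (simp add: V0 V_nonneg)
  have Qu: "Q (u j) \<zeta> = u (Suc j) \<zeta>" if "\<zeta> \<in> sphere 0 1" for j \<zeta>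
    unfolding Q_def u_def
    by (subst poisson_integral_semigroup[OF g(1) rp rs[OF that]]) (simp add: mult_ac)
  define S where "S n \<zeta> = (\<Sum>j<n. u j \<zeta> - \<alpha>)" for n \<zeta>
  have S_Suc: "S (Suc n) \<zeta> = S n \<zeta> + (u n \<zeta> - \<alpha>)" for n \<zeta> by (simp add: S_def)
  have S_int: "integrable circle_measure (S n)" for n
    unfolding S_def[abs_def] by (intro Bochner_Integration.integrable_sum Bochner_Integration.integrable_diff u_int circle.integrable_const)
  have QS: "u 0 \<zeta> - \<alpha> + Q (S n) \<zeta> = S (Suc n) \<zeta>" if \<zeta>: "\<zeta> \<in> sphere 0 1" for n \<zeta>
  proof (induction n)
    case 0
    show ?case using poisson_integral_const[OF rs[OF \<zeta>], of 0] by (simp add: S_def Q_def)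
  next
    case (Suc n)
    have "S (Suc n) = (\<lambda>\<zeta>. S n \<zeta> + (u n \<zeta> - \<alpha>))" by (rule ext) (rule S_Suc)
    then have "Q (S (Suc n)) \<zeta> = Q (S n) \<zeta> + (Q (u n) \<zeta> - \<alpha>)"
      unfolding Q_def
      by (simp add: poisson_integral_add poisson_integral_diff S_int u_int rs[OF \<zeta>] poisson_integral_const)
    then show ?case using Suc Qu[OF \<zeta>, of n] S_Suc[of n \<zeta>] S_Suc[of "Suc n" \<zeta>] by linarith
  qed
  have S_le_V: "S n \<zeta> \<le> V n \<zeta>" if "\<zeta> \<in> sphere 0 1" for n \<zeta>
    using that
  proof (induction n arbitrary: \<zeta>)
    case (Suc n)
    have "Q (S n) \<zeta> \<le> Q (V n) \<zeta>"
      unfolding Q_def by (rule poisson_integral_mono[OF S_int V_int rs[OF Suc.prems]]) (rule Suc.IH)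
    then show ?case using QS[OF Suc.prems, of n] unfolding VS by simp
  qed (simp add: V0 S_def)
  define E where "E n = {\<zeta> \<in> space circle_measure. 0 < V n \<zeta>}" for n
  have V_meas: "V n \<in> borel_measurable circle_measure" for n
    by (rule measurable_circle_continuous[OF V_cont])
  have E_sets: "E n \<in> sets circle_measure" for n
    unfolding E_def using V_meas[of n] by measurable
  have E_measure: "measure circle_measure (E n) \<le> (LINT \<zeta>|circle_measure. g \<zeta>) / \<alpha>" for n
  proof -
    have int1: "integrable circle_measure (\<lambda>\<zeta>. indicator (E n) \<zeta> * u 0 \<zeta>)"
      using integrable_mult_indicator[OF E_sets u_int, of n 0] by simp
    have int2: "integrable circle_measure (\<lambda>\<zeta>. indicator (E n) \<zeta> * \<alpha>)"
      using E_sets by (simp add: less_top[symmetric])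
    have int3: "integrable circle_measure (Q (V n))"
      by (rule circle_integrable_continuous[OF Q_cont[OF V_int]])
    have "(LINT \<zeta>|circle_measure. V n \<zeta>) \<le> (LINT \<zeta>|circle_measure.
        indicator (E n) \<zeta> * u 0 \<zeta> - indicator (E n) \<zeta> * \<alpha> + Q (V n) \<zeta>)"
    proof (rule integral_mono[OF V_int])
      show "integrable circle_measure (\<lambda>\<zeta>. indicator (E n) \<zeta> * u 0 \<zeta> - indicator (E n) \<zeta> * \<alpha> + Q (V n) \<zeta>)"
        by (intro Bochner_Integration.integrable_add Bochner_Integration.integrable_diff int1 int2 int3)
      fix \<zeta> assume \<zeta>: "\<zeta> \<in> space circle_measure"
      have Qn: "0 \<le> Q (V n) \<zeta>"
        unfolding Q_def using \<zeta> by (intro poisson_integral_nonneg V_int V_nonneg rs) simp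
      show "V n \<zeta> \<le> indicator (E n) \<zeta> * u 0 \<zeta> - indicator (E n) \<zeta> * \<alpha> + Q (V n) \<zeta>"
      proof (cases "\<zeta> \<in> E n")
        case False
        then show ?thesis using \<zeta> Qn V_nonneg[of n \<zeta>] by (simp add: E_def)
      next
        case True
        then have pos: "0 < V n \<zeta>" by (simp add: E_def)
        then obtain m where m: "n = Suc m" by (cases n) (auto simp: V0)
        have "V n \<zeta> = u 0 \<zeta> - \<alpha> + Q (V m) \<zeta>" using pos unfolding m VS by (simp add: max_def split: if_splits)
        moreover have "Q (V m) \<zeta> \<le> Q (V n) \<zeta>"
          unfolding Q_def m using \<zeta> by (intro poisson_integral_mono V_int rs V_mono) auto
        ultimately show ?thesis using True by simp
      qed
    qed
    also have "\<dots> = (LINT \<zeta>|circle_measure. indicator (E n) \<zeta> * u 0 \<zeta>) -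
        (LINT \<zeta>|circle_measure. indicator (E n) \<zeta> * \<alpha>) + (LINT \<zeta>|circle_measure. Q (V n) \<zeta>)"
      using int1 int2 int3 by simp
    also have "(LINT \<zeta>|circle_measure. Q (V n) \<zeta>) = (LINT \<zeta>|circle_measure. V n \<zeta>)"
      unfolding Q_def by (rule poisson_integral_mean[OF V_int]) (use r in auto)
    also have "(LINT \<zeta>|circle_measure. indicator (E n) \<zeta> * \<alpha>) = measure circle_measure (E n) * \<alpha>"
      using sets.sets_into_space[OF E_sets, of n] by (simp add: Int_absorb2)
    finally have "measure circle_measure (E n) * \<alpha> \<le> (LINT \<zeta>|circle_measure. indicator (E n) \<zeta> * u 0 \<zeta>)"
      by simp
    also have "\<dots> \<le> (LINT \<zeta>|circle_measure. u 0 \<zeta>)"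
    proof (rule integral_mono[OF int1 u_int])
      fix \<zeta> assume "\<zeta> \<in> space circle_measure"
      then have "0 \<le> u 0 \<zeta>"
        unfolding u_def using rs[of \<zeta>] by (intro poisson_integral_nonneg g) auto
      then show "indicator (E n) \<zeta> * u 0 \<zeta> \<le> u 0 \<zeta>" by (simp add: indicator_def)
    qed
    also have "\<dots> = (LINT \<zeta>|circle_measure. g \<zeta>)"
      unfolding u_def using poisson_integral_mean[OF g(1) rp[of 0]] by simp
    finally show ?thesis using \<alpha> by (simp add: field_simps)
  qed
  have "incseq E"
    by (rule incseq_SucI) (use V_mono in \<open>force simp: E_def intro: less_le_trans\<close>)
  then have "(\<lambda>n. measure circle_measure (E n)) \<longlonglongrightarrow> measure circle_measure (\<Union>n. E n)"
    using E_sets by (intro circle.finite_Lim_measure_incseq) auto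
  then have "measure circle_measure (\<Union>n. E n) \<le> (LINT \<zeta>|circle_measure. g \<zeta>) / \<alpha>"
    by (rule LIMSEQ_le_const2) (use E_measure in auto)
  moreover have "\<zeta> \<in> (\<Union>n. E n)"
    if \<zeta>: "\<zeta> \<in> sphere 0 1" and n: "real n * \<alpha> < (\<Sum>j<n. poisson_integral g (of_real (r ^ Suc j) * \<zeta>))" for \<zeta> n
  proof -
    have "0 < S n \<zeta>" using n by (simp add: S_def u_def sum_subtractf)
    then have "\<zeta> \<in> E n" using S_le_V[OF \<zeta>, of n] \<zeta> by (simp add: E_def)
    then show ?thesis by blast
  qed
  ultimately show ?thesis using E_sets by (intro bexI[of _ "\<Union>n. E n"]) auto
qed

text \<open>
  Harnack's inequality reduces the supremum over all radii up to \<open>r\<close> to the averages in Hopf's lemma. A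
  radius \<open>\<rho> \<le> r\<close> lies between \<open>r ^ Suc n\<close> and \<open>r ^ n\<close> for some \<open>n > 0\<close>, which costs a factor
  \<open>8\<close>. The value at \<open>r ^ n\<close> is at most \<open>8\<close> times the value at each \<open>r ^ i\<close> with \<open>n / 2 \<le> i \<le> n\<close>; at
  least half of the first \<open>n\<close> powers are of this kind, so the average over all of them is at least \<open>1 / 16\<close> of
  the value at \<open>r ^ n\<close>. Together these give the constant \<open>128\<close>.
\<close>

lemma maximal_poisson:
  fixes g :: "complex \<Rightarrow> real" and r \<alpha> :: real
  assumes g: "integrable circle_measure g" "\<And>\<zeta>. \<zeta> \<in> sphere 0 1 \<Longrightarrow> 0 \<le> g \<zeta>"
    and r: "0 < r" "r < 1" and \<alpha>: "0 < \<alpha>"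
  shows "\<exists>A\<in>sets circle_measure. measure circle_measure A \<le> (LINT \<zeta>|circle_measure. g \<zeta>) / \<alpha> \<and>
    (\<forall>\<zeta>\<in>sphere 0 1. \<forall>\<rho>. 0 < \<rho> \<longrightarrow> \<rho> \<le> r \<longrightarrow> 128 * \<alpha> < poisson_integral g (of_real \<rho> * \<zeta>) \<longrightarrow> \<zeta> \<in> A)"
proof -
  obtain A where A: "A \<in> sets circle_measure" "measure circle_measure A \<le> (LINT \<zeta>|circle_measure. g \<zeta>) / \<alpha>"
    "\<And>\<zeta> n. \<zeta> \<in> sphere 0 1 \<Longrightarrow> real n * \<alpha> < (\<Sum>j<n. poisson_integral g (of_real (r ^ Suc j) * \<zeta>)) \<Longrightarrow> \<zeta> \<in> A"
    using hopf_maximal_poisson[OF g r \<alpha>] by blast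
  have "\<zeta> \<in> A" if \<zeta>: "\<zeta> \<in> sphere 0 1" and \<rho>: "0 < \<rho>" "\<rho> \<le> r"
    and big: "128 * \<alpha> < poisson_integral g (of_real \<rho> * \<zeta>)" for \<zeta> \<rho>
  proof -
    define u where "u t = poisson_integral g (of_real t * \<zeta>)" for t :: real
    have harnack: "u t \<le> 8 * u s" if "0 \<le> s" "s < 1" "s\<^sup>2 \<le> t" "t \<le> s" for s t
      unfolding u_def using poisson_integral_harnack[OF g that] \<zeta> by simp
    have r1: "r ^ k < 1" if "k > 0" for k using r that by (simp add: power_less_one_iff)
    obtain k0 where "r ^ k0 < \<rho>" using real_arch_pow_inv[OF \<rho>(1) r(2)] by blast
    \<comment> \<open>the first power below \<open>\<rho>\<close>; it is neither of the powers \<open>0\<close> and \<open>1\<close>, as \<open>\<rho> \<le> r < 1\<close>\<close>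
    define k where "k = (LEAST k. r ^ k < \<rho>)"
    have k: "r ^ k < \<rho>" unfolding k_def by (rule LeastI[where P="\<lambda>k. r ^ k < \<rho>", OF \<open>r ^ k0 < \<rho>\<close>])
    have k_least: "\<rho> \<le> r ^ j" if "j < k" for j
      using not_less_Least[of j "\<lambda>k. r ^ k < \<rho>"] that by (simp add: k_def not_less)
    have "k \<noteq> 0" using k \<rho> r by (intro notI) simp
    moreover have "k \<noteq> 1" using k \<rho> by (intro notI) simp
    ultimately obtain n where n: "k = Suc n" "0 < n" by (cases k) auto
    have "(r ^ n)\<^sup>2 \<le> r ^ k"
      unfolding power_mult[symmetric] using n r by (intro power_decreasing) auto
    then have "u \<rho> \<le> 8 * u (r ^ n)"
      using k k_least[of n] n r r1[of n] by (intro harnack) auto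
    then have un: "16 * \<alpha> < u (r ^ n)" using big by (simp add: u_def)
    \<comment> \<open>the exponents \<open>Suc j\<close> from \<open>n / 2\<close>, rounded up, to \<open>n\<close>\<close>
    let ?J = "{(n + 1) div 2 - 1..<n}"
    have "2 * \<alpha> < u (r ^ Suc j)" if "j \<in> ?J" for j
    proof -
      have "n \<le> Suc j * 2" using that by auto
      then have "(r ^ Suc j)\<^sup>2 \<le> r ^ n"
        unfolding power_mult[symmetric] using r by (intro power_decreasing) auto
      moreover have "r ^ n \<le> r ^ Suc j" using that r by (intro power_decreasing) auto
      ultimately have "u (r ^ n) \<le> 8 * u (r ^ Suc j)" using r r1[of "Suc j"] by (intro harnack) auto
      then show ?thesis using un by simp
    qed
    then have "(\<Sum>j\<in>?J. 2 * \<alpha>) < (\<Sum>j\<in>?J. u (r ^ Suc j))"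
      using n by (intro sum_strict_mono) auto
    moreover have "real n * \<alpha> \<le> (\<Sum>j\<in>?J. 2 * \<alpha>)"
    proof -
      have "n \<le> card ?J * 2" using n by simp
      then have "real n \<le> real (card ?J) * 2" by linarith
      from mult_right_mono[OF this, of \<alpha>] show ?thesis using \<alpha> by (simp add: mult.assoc)
    qed
    moreover have "(\<Sum>j\<in>?J. u (r ^ Suc j)) \<le> (\<Sum>j<n. u (r ^ Suc j))"
    proof (rule sum_mono2)
      fix j assume "j \<in> {..<n} - ?J"
      have "norm (of_real (r ^ Suc j) * \<zeta>) < 1"
        using \<zeta> r r1[of "Suc j"] by (simp add: norm_mult norm_power)
      then show "0 \<le> u (r ^ Suc j)" unfolding u_def by (intro poisson_integral_nonneg g)
    qed auto
    ultimately have "real n * \<alpha> < (\<Sum>j<n. u (r ^ Suc j))" by linarith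
    then show ?thesis using A(3)[OF \<zeta>] by (simp add: u_def)
  qed
  then show ?thesis using A(1,2) by blast
qed

section \<open>Radial limits\<close>

text \<open>
  A sequence of radii increasing to \<open>1\<close>; along it the integral theorems for sequences apply.
\<close>

definition radius :: "nat \<Rightarrow> real" where
  "radius k = 1 - 1 / (real k + 2)"

lemma radius_bounds: "0 < radius k" "radius k < 1"
  by (simp_all add: radius_def field_simps)

lemma radius_mono: "j \<le> k \<Longrightarrow> radius j \<le> radius k"
  by (simp add: radius_def frac_le)

lemma radius_tendsto: "radius \<longlonglongrightarrow> 1"
proof -
  have "(\<lambda>k. 1 / real (k + 2)) \<longlonglongrightarrow> 0"
    by (rule LIMSEQ_ignore_initial_segment) (rule lim_1_over_n)
  from tendsto_diff[OF tendsto_const[of 1] this] show ?thesis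
    by (simp add: radius_def[abs_def] add.commute)
qed

lemma radius_at_left: "filterlim radius (at_left 1) sequentially"
  unfolding filterlim_at using radius_tendsto radius_bounds
  by (auto simp: less_imp_neq)

text \<open>
  Open subsets of the circle are measurable, so suprema over uncountably many radii cause no measurability
  problem.
\<close>

lemma circle_sup_sets:
  fixes f :: "'i \<Rightarrow> complex \<Rightarrow> real"
  assumes "\<And>t. t \<in> I \<Longrightarrow> continuous_on (sphere 0 1) (f t)"
  shows "{\<zeta> \<in> sphere 0 1. \<exists>t\<in>I. a < f t \<zeta>} \<in> sets circle_measure"
proof -
  have "openin (top_of_set (sphere 0 1)) (\<Union>t\<in>I. sphere 0 1 \<inter> f t -` {a<..})"
    by (intro openin_Union ballI) (auto intro!: continuous_openin_preimage_gen assms)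
  then obtain T where T: "open T" "(\<Union>t\<in>I. sphere 0 1 \<inter> f t -` {a<..}) = sphere 0 1 \<inter> T"
    by (auto simp: openin_open)
  have "{\<zeta> \<in> sphere 0 1. \<exists>t\<in>I. a < f t \<zeta>} = sphere 0 1 \<inter> T"
    unfolding T(2)[symmetric] by auto
  then show ?thesis
    using T(1) by (auto simp: sets_circle sets_restrict_space)
qed

lemma summable_l2_dilation:
  fixes c :: "nat \<Rightarrow> complex"
  assumes c: "summable (\<lambda>n. (norm (c n))\<^sup>2)" and r: "0 \<le> r" "r < 1"
  shows "summable (\<lambda>n. norm (c n * of_real r ^ n))"
proof (rule summable_comparison_test')
  have "r\<^sup>2 < 1" using r by (simp add: power_less_one_iff abs_square_less_1)
  then show "summable (\<lambda>n. (norm (c n))\<^sup>2 + (r\<^sup>2) ^ n)"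
    by (intro summable_add c summable_geometric) simp
  fix n
  have "2 * norm (c n) * r ^ n \<le> (norm (c n))\<^sup>2 + (r ^ n)\<^sup>2" by (rule sum_squares_bound)
  moreover have "0 \<le> norm (c n) * r ^ n" using r by simp
  moreover have "(r ^ n)\<^sup>2 = (r\<^sup>2) ^ n" by (simp add: power_mult[symmetric] mult.commute)
  moreover have "norm (norm (c n * of_real r ^ n)) = norm (c n) * r ^ n"
    using r by (simp add: norm_mult norm_power)
  ultimately show "norm (norm (c n * of_real r ^ n)) \<le> (norm (c n))\<^sup>2 + (r\<^sup>2) ^ n"
    by linarith
qed

lemma power_series_dilation:
  "power_series (\<lambda>n. c n * of_real r ^ n) \<zeta> = power_series c (of_real r * \<zeta>)"
  by (simp add: power_series_def power_mult_distrib mult.assoc)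

lemma summable_l2_disk:
  fixes c :: "nat \<Rightarrow> complex"
  assumes c: "summable (\<lambda>n. (norm (c n))\<^sup>2)" and z: "norm z < 1"
  shows "summable (\<lambda>n. c n * z ^ n)"
proof -
  have "summable (\<lambda>n. norm (c n * of_real (norm z) ^ n))"
    using summable_l2_dilation[OF c, of "norm z"] z by simp
  then have "summable (\<lambda>n. norm (c n * z ^ n))" by (simp add: norm_mult norm_power)
  then show ?thesis by (rule summable_norm_cancel)
qed

lemma continuous_power_series_dilation:
  assumes c: "summable (\<lambda>n. (norm (c n))\<^sup>2)" and r: "0 \<le> r" "r < 1"
  shows "continuous_on (cball 0 1) (\<lambda>\<zeta>. power_series c (of_real r * \<zeta>))"
  using continuous_power_series[OF summable_l2_dilation[OF assms]]
  by (simp only: power_series_dilation cong: continuous_on_cong)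

lemma parseval_dilation:
  assumes c: "summable (\<lambda>n. (norm (c n))\<^sup>2)" and r: "0 \<le> r" "r < 1"
  shows "(\<lambda>n. (norm (c n))\<^sup>2 * (r ^ n)\<^sup>2) sums
    (LINT \<zeta>|circle_measure. (norm (power_series c (of_real r * \<zeta>)))\<^sup>2)"
  using parseval_power_series[OF summable_l2_dilation[OF assms]] r
  by (simp add: power_series_dilation norm_mult norm_power power_mult_distrib)

text \<open>
  The weak-type inequality for the radial maximal function of a power series with square-summable
  coefficients. For \<open>R < 1\<close> the square of the dilation by \<open>R\<close> is dominated by its Poisson integral, whose
  mass is at most \<open>\<Sum>n. (norm (c n))\<^sup>2\<close> by Parseval; then \<open>R\<close> tends to \<open>1\<close>.
\<close>

lemma maximal_power_series:
  fixes c :: "nat \<Rightarrow> complex"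
  assumes c: "summable (\<lambda>n. (norm (c n))\<^sup>2)" and \<alpha>: "0 < \<alpha>"
  shows "\<exists>A\<in>sets circle_measure. measure circle_measure A \<le> (\<Sum>n. (norm (c n))\<^sup>2) / \<alpha> \<and>
    (\<forall>\<zeta>\<in>sphere 0 1. \<forall>t. 0 < t \<longrightarrow> t < 1 \<longrightarrow> 128 * \<alpha> < (norm (power_series c (of_real t * \<zeta>)))\<^sup>2 \<longrightarrow> \<zeta> \<in> A)"
proof -
  \<comment> \<open>the bound \<open>(radius k)\<^sup>2\<close> is the product of the dilation \<open>R\<close> and the largest radius \<open>R\<close> allowed
    in the Poisson maximal inequality, both equal to \<open>radius k\<close>\<close>
  define W where "W k = {\<zeta> \<in> sphere 0 1. \<exists>t\<in>{0<..(radius k)\<^sup>2}. 128 * \<alpha> < (norm (power_series c (of_real t * \<zeta>)))\<^sup>2}" for k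
  have sq: "(radius k)\<^sup>2 < 1" for k
    using radius_bounds[of k] by (simp add: abs_square_less_1)
  have W_sets: "W k \<in> sets circle_measure" for k
    unfolding W_def
  proof (rule circle_sup_sets)
    fix t assume "t \<in> {0<..(radius k)\<^sup>2}"
    then have t: "0 \<le> t" "t < 1" using sq[of k] by auto
    show "continuous_on (sphere 0 1) (\<lambda>\<zeta>. (norm (power_series c (of_real t * \<zeta>)))\<^sup>2)"
      by (intro continuous_on_power continuous_on_norm
          continuous_on_subset[OF continuous_power_series_dilation[OF c t]]) auto
  qed
  have W_measure: "measure circle_measure (W k) \<le> (\<Sum>n. (norm (c n))\<^sup>2) / \<alpha>" for k
  proof -
    define R where "R = radius k"
    have R: "0 < R" "R < 1" using radius_bounds by (simp_all add: R_def)
    define g where "g = (\<lambda>\<zeta>. (norm (power_series c (of_real R * \<zeta>)))\<^sup>2)"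
    have g_int: "integrable circle_measure g"
      unfolding g_def
      by (intro circle_integrable_continuous continuous_on_power continuous_on_norm
          continuous_on_subset[OF continuous_power_series_dilation[OF c]]) (use R in auto)
    have pars: "(\<lambda>n. (norm (c n))\<^sup>2 * (R ^ n)\<^sup>2) sums (LINT \<zeta>|circle_measure. g \<zeta>)"
      unfolding g_def by (rule parseval_dilation[OF c]) (use R in auto)
    have le: "(LINT \<zeta>|circle_measure. g \<zeta>) \<le> (\<Sum>n. (norm (c n))\<^sup>2)"
    proof (rule sums_le[OF _ pars summable_sums[OF c]])
      fix n
      have "(R ^ n)\<^sup>2 \<le> 1" using R by (simp add: power_le_one)
      then show "(norm (c n))\<^sup>2 * (R ^ n)\<^sup>2 \<le> (norm (c n))\<^sup>2" by (simp add: mult_left_le)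
    qed
    obtain A where A: "A \<in> sets circle_measure" "measure circle_measure A \<le> (LINT \<zeta>|circle_measure. g \<zeta>) / \<alpha>"
      "\<And>\<zeta> \<rho>. \<zeta> \<in> sphere 0 1 \<Longrightarrow> 0 < \<rho> \<Longrightarrow> \<rho> \<le> R \<Longrightarrow> 128 * \<alpha> < poisson_integral g (of_real \<rho> * \<zeta>) \<Longrightarrow> \<zeta> \<in> A"
      using maximal_poisson[OF g_int _ R \<alpha>] by (auto simp: g_def)
    have "W k \<subseteq> A"
    proof
      fix \<zeta> assume "\<zeta> \<in> W k"
      then obtain t where \<zeta>: "\<zeta> \<in> sphere 0 1" and t: "0 < t" "t \<le> R\<^sup>2"
        and big: "128 * \<alpha> < (norm (power_series c (of_real t * \<zeta>)))\<^sup>2"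
        by (auto simp: W_def R_def)
      define \<rho> where "\<rho> = t / R"
      have \<rho>: "0 < \<rho>" "\<rho> \<le> R" "t = R * \<rho>" using t R by (auto simp: \<rho>_def field_simps power2_eq_square)
      have n: "norm (of_real \<rho> * \<zeta>) < 1" using \<rho> R \<zeta> by (simp add: norm_mult)
      have "(norm (power_series c (of_real t * \<zeta>)))\<^sup>2 \<le> poisson_integral g (of_real \<rho> * \<zeta>)"
        using norm_power_series_poisson[OF summable_l2_dilation[OF c, of R] n] R
        unfolding power_series_dilation g_def \<rho>(3) by (simp add: mult.assoc)
      then show "\<zeta> \<in> A" using A(3)[OF \<zeta> \<rho>(1,2)] big by linarith
    qed
    then have "measure circle_measure (W k) \<le> measure circle_measure A"
      by (rule circle.finite_measure_mono[OF _ A(1)])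
    also have "\<dots> \<le> (\<Sum>n. (norm (c n))\<^sup>2) / \<alpha>"
      using A(2) divide_right_mono[OF le, of \<alpha>] \<alpha> by linarith
    finally show ?thesis .
  qed
  have "incseq W"
  proof (rule incseq_SucI)
    fix k
    have "(radius k)\<^sup>2 \<le> (radius (Suc k))\<^sup>2"
      using radius_bounds[of k] radius_mono[of k "Suc k"] by (intro power_mono) auto
    then show "W k \<subseteq> W (Suc k)" unfolding W_def by fastforce
  qed
  then have "(\<lambda>n. measure circle_measure (W n)) \<longlonglongrightarrow> measure circle_measure (\<Union>n. W n)"
    using W_sets by (intro circle.finite_Lim_measure_incseq) auto
  then have "measure circle_measure (\<Union>n. W n) \<le> (\<Sum>n. (norm (c n))\<^sup>2) / \<alpha>"
    by (rule LIMSEQ_le_const2) (use W_measure in auto)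
  moreover have "\<zeta> \<in> (\<Union>n. W n)" if \<zeta>: "\<zeta> \<in> sphere 0 1" and t: "0 < t" "t < 1"
    and big: "128 * \<alpha> < (norm (power_series c (of_real t * \<zeta>)))\<^sup>2" for \<zeta> t
  proof -
    have "(\<lambda>k. (radius k)\<^sup>2) \<longlonglongrightarrow> 1\<^sup>2" by (intro tendsto_power radius_tendsto)
    then have "eventually (\<lambda>k. t < (radius k)\<^sup>2) sequentially"
      by (rule order_tendstoD) (use t in simp)
    then obtain k where "t < (radius k)\<^sup>2" by (auto simp: eventually_sequentially)
    then have "\<zeta> \<in> W k" using \<zeta> t big by (auto simp: W_def intro!: bexI[of _ t])
    then show ?thesis by blast
  qed
  ultimately show ?thesis using W_sets by (intro bexI[of _ "\<Union>n. W n"]) auto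
qed

text \<open>
  Dominated convergence for series. By Parseval this is the convergence of the dilates of \<open>F\<close> to \<open>F\<close>, and
  it controls both the exceptional sets and the \<open>L\<^sup>2\<close> distances below.
\<close>

lemma l2_dilation_tendsto:
  fixes c :: "nat \<Rightarrow> complex"
  assumes c: "summable (\<lambda>n. (norm (c n))\<^sup>2)"
  shows "(\<lambda>k. \<Sum>n. (norm (c n))\<^sup>2 * (1 - radius k ^ n)\<^sup>2) \<longlonglongrightarrow> 0"
proof -
  have "((\<lambda>k. \<Sum>n. (norm (c n))\<^sup>2 * (1 - radius k ^ n)\<^sup>2) \<longlongrightarrow> (\<Sum>n. (norm (c n))\<^sup>2 * (1 - 1 ^ n)\<^sup>2)) sequentially"
  proof (rule tannerys_theorem[THEN conjunct2, THEN conjunct2, OF _ _ c])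
    show "((\<lambda>k. (norm (c n))\<^sup>2 * (1 - radius k ^ n)\<^sup>2) \<longlonglongrightarrow> (norm (c n))\<^sup>2 * (1 - 1 ^ n)\<^sup>2)" for n
      by (intro tendsto_intros radius_tendsto)
    show "\<forall>\<^sub>F (n, k) in sequentially \<times>\<^sub>F sequentially. norm ((norm (c n))\<^sup>2 * (1 - radius k ^ n)\<^sup>2) \<le> (norm (c n))\<^sup>2"
    proof (intro always_eventually allI, clarify)
      fix n k
      have "(1 - radius k ^ n)\<^sup>2 \<le> 1"
        using radius_bounds[of k] by (intro power_le_one) (auto intro: power_le_one)
      then show "norm ((norm (c n))\<^sup>2 * (1 - radius k ^ n)\<^sup>2) \<le> (norm (c n))\<^sup>2"
        by (simp add: mult_left_le)
    qed
  qed simp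
  then show ?thesis by simp
qed

lemma l2_multiplier_summable:
  fixes c :: "nat \<Rightarrow> complex"
  assumes c: "summable (\<lambda>n. (norm (c n))\<^sup>2)" and "\<And>n. \<bar>w n\<bar> \<le> 1"
  shows "summable (\<lambda>n. (norm (c n))\<^sup>2 * (w n)\<^sup>2)"
proof (rule summable_comparison_test'[OF c])
  fix n
  have "(w n)\<^sup>2 \<le> 1" using assms(2)[of n] by (simp add: abs_square_le_1)
  then show "norm ((norm (c n))\<^sup>2 * (w n)\<^sup>2) \<le> (norm (c n))\<^sup>2" by (simp add: mult_left_le)
qed

text \<open>
  Completeness of the plane, in the form in which it is used on radii: a function that is eventually
  within every \<open>e\<close> of some point has a limit.
\<close>

lemma tendsto_at_left_of_approx:
  fixes h :: "real \<Rightarrow> complex"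
  assumes "\<And>e. 0 < e \<Longrightarrow> \<exists>l. \<forall>\<^sub>F r in at_left 1. dist (h r) l \<le> e"
  shows "\<exists>l. (h \<longlongrightarrow> l) (at_left 1)"
proof -
  define x where "x k = h (radius k)" for k
  have "Cauchy x"
  proof (rule metric_CauchyI)
    fix e :: real assume "0 < e"
    then obtain l where "\<forall>\<^sub>F r in at_left 1. dist (h r) l \<le> e / 3" using assms[of "e / 3"] by auto
    from eventually_compose_filterlim[OF this radius_at_left]
    obtain K where K: "\<And>k. k \<ge> K \<Longrightarrow> dist (x k) l \<le> e / 3"
      by (auto simp: eventually_sequentially x_def)
    have "dist (x m) (x n) < e" if "m \<ge> K" "n \<ge> K" for m n
      using K[OF that(1)] K[OF that(2)] dist_triangle2[of "x m" "x n" l] \<open>0 < e\<close> by linarith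
    then show "\<exists>M. \<forall>m\<ge>M. \<forall>n\<ge>M. dist (x m) (x n) < e" by blast
  qed
  then obtain l where l: "x \<longlonglongrightarrow> l" using Cauchy_convergent_iff convergent_def by blast
  have "(h \<longlongrightarrow> l) (at_left 1)"
  proof (rule tendstoI)
    fix e :: real assume e: "0 < e"
    then obtain l' where l': "\<forall>\<^sub>F r in at_left 1. dist (h r) l' \<le> e / 3" using assms[of "e / 3"] by auto
    have "dist l l' \<le> e / 3"
    proof (rule tendsto_upperbound)
      show "(\<lambda>k. dist (x k) l') \<longlonglongrightarrow> dist l l'" by (intro tendsto_dist l tendsto_const)
      show "\<forall>\<^sub>F k in sequentially. dist (x k) l' \<le> e / 3"
        unfolding x_def by (rule eventually_compose_filterlim[OF l' radius_at_left])
    qed simp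
    show "\<forall>\<^sub>F r in at_left 1. dist (h r) l < e"
      using l'
    proof eventually_elim
      case (elim r)
      then show ?case using \<open>dist l l' \<le> e / 3\<close> dist_triangle2[of "h r" l l'] e by linarith
    qed
  qed
  then show ?thesis ..
qed

lemma power_series_diff_dilation:
  assumes c: "summable (\<lambda>n. (norm (c n))\<^sup>2)" and s: "0 \<le> s" "s \<le> 1" and z: "norm z < 1"
  shows "power_series (\<lambda>n. c n * of_real (1 - s ^ n)) z = power_series c z - power_series c (of_real s * z)"
proof -
  have "norm (of_real s * z) < 1" using s z mult_left_le_one_le[of "norm z" s] by (simp add: norm_mult)
  from sums_diff[OF summable_sums[OF summable_l2_disk[OF c z]] summable_sums[OF summable_l2_disk[OF c this]]]
  have "(\<lambda>n. c n * of_real (1 - s ^ n) * z ^ n) sums (power_series c z - power_series c (of_real s * z))"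
    by (simp add: power_series_def algebra_simps power_mult_distrib)
  then show ?thesis by (simp add: power_series_def sums_iff)
qed

text \<open>
  Let \<open>F\<close> be the power series and \<open>F\<^sub>s\<close> its dilation by \<open>s\<close>. Along each radius \<open>F\<^sub>s\<close> has a limit, since
  it is continuous on the closed disk, so the oscillation of \<open>F\<close> at the boundary is at most twice the
  supremum of \<open>norm (F - F\<^sub>s)\<close> on the radius. The maximal inequality applied to \<open>F - F\<^sub>s\<close> shows that this
  supremum exceeds a given bound only on a set whose measure tends to \<open>0\<close> as \<open>s\<close> tends to \<open>1\<close>.
\<close>

theorem radial_limit_AE:
  assumes c: "summable (\<lambda>n. (norm (c n))\<^sup>2)"
  shows "AE \<zeta> in circle_measure. \<exists>l. ((\<lambda>r. power_series c (of_real r * \<zeta>)) \<longlongrightarrow> l) (at_left 1)"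
proof -
  let ?F = "power_series c"
  define \<eta> where "\<eta> k = (\<Sum>n. (norm (c n))\<^sup>2 * (1 - radius k ^ n)\<^sup>2)" for k
  have w: "\<bar>1 - radius k ^ n\<bar> \<le> 1" for k n
    using radius_bounds[of k] by (simp add: power_le_one)
  define e where "e m = 1 / real (Suc m)" for m
  \<comment> \<open>the exceptional set for the threshold \<open>e m\<close> and the dilation \<open>radius k\<close>; the factor \<open>128\<close> turns the
    constant of the maximal inequality into the threshold itself\<close>
  define P where "P m k A \<longleftrightarrow> A \<in> sets circle_measure \<and> measure circle_measure A \<le> \<eta> k / ((e m)\<^sup>2 / 128) \<and>
      (\<forall>\<zeta>\<in>sphere 0 1. \<forall>t. 0 < t \<longrightarrow> t < 1 \<longrightarrow> e m < norm (?F (of_real t * \<zeta>) - ?F (of_real (radius k) * (of_real t * \<zeta>))) \<longrightarrow> \<zeta> \<in> A)" for m k A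
  have ex: "\<exists>A. P m k A" for m k
  proof -
    let ?d = "\<lambda>n. c n * of_real (1 - radius k ^ n)"
    have nd: "(norm (?d n))\<^sup>2 = (norm (c n))\<^sup>2 * (1 - radius k ^ n)\<^sup>2" for n
      by (simp only: norm_mult norm_of_real power_mult_distrib power2_abs)
    have d: "summable (\<lambda>n. (norm (?d n))\<^sup>2)"
      unfolding nd by (rule l2_multiplier_summable[OF c w])
    have em: "0 < e m" by (simp add: e_def)
    then have "0 < (e m)\<^sup>2 / 128" by simp
    from maximal_power_series[OF d this] obtain A where A: "A \<in> sets circle_measure"
      "measure circle_measure A \<le> \<eta> k / ((e m)\<^sup>2 / 128)"
      "\<And>\<zeta> t. \<zeta> \<in> sphere 0 1 \<Longrightarrow> 0 < t \<Longrightarrow> t < 1 \<Longrightarrow> (e m)\<^sup>2 < (norm (power_series ?d (of_real t * \<zeta>)))\<^sup>2 \<Longrightarrow> \<zeta> \<in> A"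
      unfolding \<eta>_def nd by auto
    have "\<zeta> \<in> A" if \<zeta>: "\<zeta> \<in> sphere 0 1" and t: "0 < t" "t < 1"
      and big: "e m < norm (?F (of_real t * \<zeta>) - ?F (of_real (radius k) * (of_real t * \<zeta>)))" for \<zeta> t
    proof (rule A(3)[OF \<zeta> t])
      have "norm (of_real t * \<zeta>) < 1" using \<zeta> t by (simp add: norm_mult)
      then show "(e m)\<^sup>2 < (norm (power_series ?d (of_real t * \<zeta>)))\<^sup>2"
        using big em radius_bounds[of k] by (subst power_series_diff_dilation[OF c]) (auto intro: power_strict_mono)
    qed
    then have "P m k A" unfolding P_def using A(1,2) by blast
    then show ?thesis ..
  qed
  define A where "A m k = (SOME A. P m k A)" for m k
  have PA: "P m k (A m k)" for m k
    unfolding A_def by (rule someI_ex[OF ex])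
  have A_sets: "A m k \<in> sets circle_measure"
    and A_measure: "measure circle_measure (A m k) \<le> \<eta> k / ((1 / real (Suc m))\<^sup>2 / 128)" for m k
    using PA[of m k] unfolding P_def e_def by blast+
  have A: "\<zeta> \<in> A m k" if "\<zeta> \<in> sphere 0 1" "0 < t" "t < 1"
      "1 / real (Suc m) < norm (?F (of_real t * \<zeta>) - ?F (of_real (radius k) * (of_real t * \<zeta>)))" for m k \<zeta> t
    using PA[of m k] that unfolding P_def e_def by blast
  define N where "N m = (\<Inter>k. A m k)" for m
  have N_sets: "N m \<in> sets circle_measure" for m
    unfolding N_def using A_sets by auto
  have "N m \<in> null_sets circle_measure" for m
  proof -
    have "measure circle_measure (N m) \<le> 0"
    proof (rule LIMSEQ_le_const)
      have "(\<lambda>k. \<eta> k / ((1 / real (Suc m))\<^sup>2 / 128)) \<longlonglongrightarrow> 0 / ((1 / real (Suc m))\<^sup>2 / 128)"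
        unfolding \<eta>_def by (intro tendsto_divide l2_dilation_tendsto[OF c] tendsto_const) simp
      then show "(\<lambda>k. \<eta> k / ((1 / real (Suc m))\<^sup>2 / 128)) \<longlonglongrightarrow> 0" by simp
      have "measure circle_measure (N m) \<le> \<eta> k / ((1 / real (Suc m))\<^sup>2 / 128)" for k
        using circle.finite_measure_mono[of "N m" "A m k"] A_sets A_measure[of m k] by (force simp: N_def)
      then show "\<exists>K. \<forall>k\<ge>K. measure circle_measure (N m) \<le> \<eta> k / ((1 / real (Suc m))\<^sup>2 / 128)" by blast
    qed
    then show ?thesis using N_sets[of m]
      by (simp add: null_sets_def circle.emeasure_eq_measure measure_le_0_iff)
  qed
  then have "AE \<zeta> in circle_measure. \<forall>m. \<zeta> \<notin> N m"
    unfolding AE_all_countable by (auto intro: AE_not_in)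
  then show ?thesis
  proof (rule AE_mp[OF _ AE_I2], intro impI)
    fix \<zeta> assume "\<zeta> \<in> space circle_measure" and notin: "\<forall>m. \<zeta> \<notin> N m"
    then have \<zeta>: "\<zeta> \<in> sphere 0 1" by simp
    show "\<exists>l. ((\<lambda>r. ?F (of_real r * \<zeta>)) \<longlongrightarrow> l) (at_left 1)"
    proof (rule tendsto_at_left_of_approx)
      fix e :: real assume e: "0 < e"
      obtain m where m: "1 / real (Suc m) < e / 2" using e nat_approx_posE[of "e / 2"] by auto
      from notin obtain k where "\<zeta> \<notin> A m k" unfolding N_def by blast
      then have close: "norm (?F (of_real t * \<zeta>) - ?F (of_real (radius k) * (of_real t * \<zeta>))) \<le> e / 2"
        if "0 < t" "t < 1" for t
        using A[OF \<zeta> that, of m k] m by force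
      have "continuous_on {0..1} (\<lambda>t. ?F (of_real (radius k) * (of_real t * \<zeta>)))"
      proof (rule continuous_on_compose2[OF continuous_power_series_dilation[OF c]])
        show "(\<lambda>t. of_real t * \<zeta>) ` {0..1} \<subseteq> cball 0 1" using \<zeta> by (auto simp: norm_mult)
      qed (use radius_bounds[of k] in \<open>auto intro!: continuous_intros\<close>)
      then have "((\<lambda>t. ?F (of_real (radius k) * (of_real t * \<zeta>))) \<longlongrightarrow> ?F (of_real (radius k) * (of_real 1 * \<zeta>))) (at 1 within {0..1})"
        unfolding continuous_on by (rule bspec) simp
      then have "((\<lambda>t. ?F (of_real (radius k) * (of_real t * \<zeta>))) \<longlongrightarrow> ?F (of_real (radius k) * \<zeta>)) (at_left 1)"
        by (simp add: at_within_Icc_at_left)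
      from tendstoD[OF this, of "e / 2"] e
      have ev: "\<forall>\<^sub>F t in at_left 1. dist (?F (of_real (radius k) * (of_real t * \<zeta>))) (?F (of_real (radius k) * \<zeta>)) < e / 2" by simp
      have "\<forall>\<^sub>F t in at_left (1::real). 0 < t \<and> t < 1"
        by (rule eventually_at_leftI[of 0]) auto
      then have "\<forall>\<^sub>F t in at_left 1. dist (?F (of_real t * \<zeta>)) (?F (of_real (radius k) * \<zeta>)) \<le> e"
        using ev
      proof eventually_elim
        case (elim t)
        then show ?case
          using close[of t] dist_triangle[of "?F (of_real t * \<zeta>)" "?F (of_real (radius k) * \<zeta>)" "?F (of_real (radius k) * (of_real t * \<zeta>))"]
          by (simp add: dist_norm)
      qed
      then show "\<exists>l. \<forall>\<^sub>F t in at_left 1. dist (?F (of_real t * \<zeta>)) l \<le> e" by blast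
    qed
  qed
qed

section \<open>Boundary functions in the space of square-integrable functions\<close>

text \<open>
  By the Cauchy criterion the radial limit exists exactly off a countable combination of the open sets where
  two values on the radius beyond \<open>radius j\<close> differ by more than \<open>1 / Suc m\<close>. Where it exists, it is the
  limit along the sequence \<open>radius\<close>; elsewhere \<open>Lim\<close> has one fixed default value, so the function is
  measurable everywhere and not merely up to a null set.
\<close>

lemma measurable_boundary_fun:
  assumes c: "summable (\<lambda>n. (norm (c n))\<^sup>2)"
  shows "boundary_fun (power_series c) \<in> borel_measurable circle_measure"
proof -
  let ?F = "power_series c"
  have cont: "continuous_on (sphere 0 1) (\<lambda>\<zeta>. ?F (of_real r * \<zeta>))" if "0 \<le> r" "r < 1" for r
    by (rule continuous_on_subset[OF continuous_power_series_dilation[OF c that]]) auto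
  define osc where "osc m j = {\<zeta> \<in> sphere 0 1. \<exists>p\<in>{radius j<..<1} \<times> {radius j<..<1}.
    1 / real (Suc m) < norm (?F (of_real (fst p) * \<zeta>) - ?F (of_real (snd p) * \<zeta>))}" for m j
  have osc_sets: "osc m j \<in> sets circle_measure" for m j
    unfolding osc_def
  proof (rule circle_sup_sets)
    fix p assume "p \<in> {radius j<..<1} \<times> {radius j<..<1}"
    then have "0 \<le> fst p" "fst p < 1" "0 \<le> snd p" "snd p < 1" using radius_bounds[of j] by auto
    then show "continuous_on (sphere 0 1) (\<lambda>\<zeta>. norm (?F (of_real (fst p) * \<zeta>) - ?F (of_real (snd p) * \<zeta>)))"
      by (intro continuous_on_norm continuous_on_diff cont)
  qed
  define C where "C = sphere 0 1 - (\<Union>m. \<Inter>j. osc m j)"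
  have C_sets: "C \<in> sets circle_measure"
    unfolding C_def space_circle[symmetric] using osc_sets by (intro sets.Diff sets.top sets.countable_UN sets.countable_INT') auto
  have C_iff: "\<zeta> \<in> C \<longleftrightarrow> (\<exists>l. ((\<lambda>r. ?F (of_real r * \<zeta>)) \<longlongrightarrow> l) (at_left 1))" if \<zeta>: "\<zeta> \<in> sphere 0 1" for \<zeta>
  proof
    assume "\<exists>l. ((\<lambda>r. ?F (of_real r * \<zeta>)) \<longlongrightarrow> l) (at_left 1)"
    then obtain l where l: "((\<lambda>r. ?F (of_real r * \<zeta>)) \<longlongrightarrow> l) (at_left 1)" by blast
    have "\<exists>j. \<zeta> \<notin> osc m j" for m
    proof -
      have "\<forall>\<^sub>F r in at_left 1. dist (?F (of_real r * \<zeta>)) l < 1 / real (Suc m) / 2"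
        by (rule tendstoD[OF l]) simp
      then obtain b where b: "b < 1" "\<And>r. b < r \<Longrightarrow> r < 1 \<Longrightarrow> dist (?F (of_real r * \<zeta>)) l < 1 / real (Suc m) / 2"
        unfolding eventually_at_left[OF zero_less_one] by blast
      have "eventually (\<lambda>j. b < radius j) sequentially" by (rule order_tendstoD(1)[OF radius_tendsto b(1)])
      then obtain j where j: "b < radius j" by (auto simp: eventually_sequentially)
      have "\<zeta> \<notin> osc m j"
      proof
        assume "\<zeta> \<in> osc m j"
        then obtain p where p: "radius j < fst p" "fst p < 1" "radius j < snd p" "snd p < 1"
          "1 / real (Suc m) < dist (?F (of_real (fst p) * \<zeta>)) (?F (of_real (snd p) * \<zeta>))"
          unfolding osc_def dist_norm by auto
        then show False
          using b(2)[of "fst p"] b(2)[of "snd p"] j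
            dist_triangle2[of "?F (of_real (fst p) * \<zeta>)" "?F (of_real (snd p) * \<zeta>)" l] by linarith
      qed
      then show ?thesis ..
    qed
    then show "\<zeta> \<in> C" using \<zeta> by (auto simp: C_def)
  next
    assume "\<zeta> \<in> C"
    show "\<exists>l. ((\<lambda>r. ?F (of_real r * \<zeta>)) \<longlongrightarrow> l) (at_left 1)"
    proof (rule tendsto_at_left_of_approx)
      fix e :: real assume "0 < e"
      then obtain m where m: "1 / real (Suc m) < e" using nat_approx_posE by blast
      from \<open>\<zeta> \<in> C\<close> obtain j where j: "\<zeta> \<notin> osc m j" unfolding C_def by blast
      have close: "dist (?F (of_real r * \<zeta>)) (?F (of_real s * \<zeta>)) \<le> e" if "radius j < r" "r < 1" "radius j < s" "s < 1" for r s
      proof (rule ccontr)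
        assume "\<not> ?thesis"
        then have "1 / real (Suc m) < norm (?F (of_real (fst (r, s)) * \<zeta>) - ?F (of_real (snd (r, s)) * \<zeta>))"
          using m by (simp add: dist_norm)
        moreover have "(r, s) \<in> {radius j<..<1} \<times> {radius j<..<1}" using that by simp
        ultimately have "\<zeta> \<in> osc m j" unfolding osc_def using \<zeta> by blast
        then show False using j by simp
      qed
      define s where "s = (radius j + 1) / 2"
      have s: "radius j < s" "s < 1" using radius_bounds[of j] by (auto simp: s_def)
      have "\<forall>\<^sub>F r in at_left 1. dist (?F (of_real r * \<zeta>)) (?F (of_real s * \<zeta>)) \<le> e"
        by (rule eventually_at_leftI[of "radius j"]) (use close s radius_bounds[of j] in auto)
      then show "\<exists>l. \<forall>\<^sub>F r in at_left 1. dist (?F (of_real r * \<zeta>)) l \<le> e" ..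
    qed
  qed
  define L where "L = (\<lambda>\<zeta>. lim (\<lambda>k. ?F (of_real (radius k) * \<zeta>)))"
  have L_meas: "L \<in> borel_measurable circle_measure"
    unfolding L_def
    by (rule borel_measurable_lim_metric) (intro measurable_circle_continuous cont less_imp_le radius_bounds)
  have "C \<inter> space circle_measure = C" unfolding C_def by auto
  then have "(\<lambda>\<zeta>. if \<zeta> \<in> C then L \<zeta> else The (\<lambda>_. False)) \<in> borel_measurable circle_measure"
    using C_sets L_meas by (intro measurable_If_set) auto
  moreover have "boundary_fun ?F \<zeta> = (if \<zeta> \<in> C then L \<zeta> else The (\<lambda>_. False))" if \<zeta>: "\<zeta> \<in> space circle_measure" for \<zeta>
  proof (cases "\<zeta> \<in> C")
    case True
    with C_iff[of \<zeta>] \<zeta> have "\<exists>l. ((\<lambda>r. ?F (of_real r * \<zeta>)) \<longlongrightarrow> l) (at_left 1)" by simp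
    then obtain l where l: "((\<lambda>r. ?F (of_real r * \<zeta>)) \<longlongrightarrow> l) (at_left 1)" ..
    have "boundary_fun ?F \<zeta> = l" unfolding boundary_fun_def by (rule tendsto_Lim[OF _ l]) simp
    moreover have "L \<zeta> = l" unfolding L_def using filterlim_compose[OF l radius_at_left] by (rule limI)
    ultimately show ?thesis using True by simp
  next
    case False
    with C_iff[of \<zeta>] \<zeta> have "\<nexists>l. ((\<lambda>r. ?F (of_real r * \<zeta>)) \<longlongrightarrow> l) (at_left 1)" by simp
    then have "(\<lambda>l. ((\<lambda>r. ?F (of_real r * \<zeta>)) \<longlongrightarrow> l) (at_left 1)) = (\<lambda>_. False)" by blast
    then show ?thesis using False by (simp add: boundary_fun_def Topological_Spaces.Lim_def)
  qed
  ultimately show ?thesis by (subst measurable_cong) auto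
qed

lemma boundary_fun_tendsto_AE:
  assumes c: "summable (\<lambda>n. (norm (c n))\<^sup>2)"
  shows "AE \<zeta> in circle_measure. (\<lambda>k. power_series c (of_real (radius k) * \<zeta>)) \<longlonglongrightarrow> boundary_fun (power_series c) \<zeta>"
  using radial_limit_AE[OF c]
proof eventually_elim
  case (elim \<zeta>)
  then obtain l where l: "((\<lambda>r. power_series c (of_real r * \<zeta>)) \<longlongrightarrow> l) (at_left 1)" by blast
  have "boundary_fun (power_series c) \<zeta> = l" unfolding boundary_fun_def by (rule tendsto_Lim[OF _ l]) simp
  then show ?case using filterlim_compose[OF l radius_at_left] by simp
qed

text \<open>
  Fatou's lemma transfers the Parseval bound for the difference of two dilates to the limit of the larger
  radius. This yields square-integrability of the boundary function without invoking completeness of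
  \<open>L\<^sup>2\<close>.
\<close>

lemma boundary_fun_L2_approx:
  assumes c: "summable (\<lambda>n. (norm (c n))\<^sup>2)"
  shows "integrable circle_measure (\<lambda>\<zeta>. (norm (boundary_fun (power_series c) \<zeta> - power_series c (of_real (radius k) * \<zeta>)))\<^sup>2)"
    and "(LINT \<zeta>|circle_measure. (norm (boundary_fun (power_series c) \<zeta> - power_series c (of_real (radius k) * \<zeta>)))\<^sup>2)
      \<le> (\<Sum>n. (norm (c n))\<^sup>2 * (1 - radius k ^ n)\<^sup>2)"
proof -
  let ?F = "power_series c" and ?b = "boundary_fun (power_series c)"
  define \<eta> where "\<eta> = (\<Sum>n. (norm (c n))\<^sup>2 * (1 - radius k ^ n)\<^sup>2)"
  have w: "\<bar>1 - radius k ^ n\<bar> \<le> 1" for n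
    using radius_bounds[of k] by (simp add: power_le_one)
  have \<eta>_sums: "(\<lambda>n. (norm (c n))\<^sup>2 * (1 - radius k ^ n)\<^sup>2) sums \<eta>"
    unfolding \<eta>_def by (rule summable_sums[OF l2_multiplier_summable[OF c w]])
  have \<eta>_nonneg: "0 \<le> \<eta>" using \<eta>_sums by (rule sums_le[OF _ sums_zero, rotated]) simp
  have cont: "continuous_on (sphere 0 1) (\<lambda>\<zeta>. ?F (of_real (radius j) * \<zeta>))" for j
    by (rule continuous_on_subset[OF continuous_power_series_dilation[OF c]]) (use radius_bounds[of j] in auto)
  have Fmeas [measurable]: "(\<lambda>\<zeta>. ?F (of_real (radius j) * \<zeta>)) \<in> borel_measurable circle_measure" for j
    by (rule measurable_circle_continuous[OF cont])
  have bmeas [measurable]: "?b \<in> borel_measurable circle_measure" by (rule measurable_boundary_fun[OF c])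
  have step: "(\<integral>\<^sup>+\<zeta>. ennreal ((norm (?F (of_real (radius j) * \<zeta>) - ?F (of_real (radius k) * \<zeta>)))\<^sup>2) \<partial>circle_measure) \<le> ennreal \<eta>"
    if "k \<le> j" for j
  proof -
    have rj: "0 \<le> radius j" "radius j < 1" and rk: "0 \<le> radius k" "radius k < 1"
      using radius_bounds[of j] radius_bounds[of k] by auto
    let ?d = "\<lambda>n. c n * of_real (radius j) ^ n - c n * of_real (radius k) ^ n"
    have sj: "summable (\<lambda>n. norm (c n * of_real (radius j) ^ n))" and sk: "summable (\<lambda>n. norm (c n * of_real (radius k) ^ n))"
      by (intro summable_l2_dilation[OF c] rj rk)+
    have sd: "summable (\<lambda>n. norm (?d n))"
      by (rule summable_comparison_test'[OF summable_add[OF sj sk], of 0]) (simp, rule norm_triangle_ineq4)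
    have pd: "power_series ?d \<zeta> = ?F (of_real (radius j) * \<zeta>) - ?F (of_real (radius k) * \<zeta>)" if "norm \<zeta> \<le> 1" for \<zeta>
    proof -
      have "summable (\<lambda>n. c n * of_real (radius j) ^ n * \<zeta> ^ n)" "summable (\<lambda>n. c n * of_real (radius k) ^ n * \<zeta> ^ n)"
        using power_series_summable_norm[OF sj that] power_series_summable_norm[OF sk that]
        by (auto dest: summable_norm_cancel)
      from suminf_diff[OF this] show ?thesis
        unfolding power_series_dilation[symmetric] unfolding power_series_def by (simp add: left_diff_distrib)
    qed
    have le: "(norm (?d n))\<^sup>2 \<le> (norm (c n))\<^sup>2 * (1 - radius k ^ n)\<^sup>2" for n
    proof -
      have "?d n = c n * of_real (radius j ^ n - radius k ^ n)" by (simp add: algebra_simps)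
      then have "(norm (?d n))\<^sup>2 = (norm (c n))\<^sup>2 * (radius j ^ n - radius k ^ n)\<^sup>2"
        by (simp only: norm_mult norm_of_real power_mult_distrib power2_abs)
      moreover have "0 \<le> radius j ^ n - radius k ^ n" "radius j ^ n - radius k ^ n \<le> 1 - radius k ^ n"
        using radius_mono[OF \<open>k \<le> j\<close>] rj rk by (auto intro: power_mono power_le_one)
      ultimately show ?thesis by (simp add: mult_left_mono power_mono)
    qed
    have "(LINT \<zeta>|circle_measure. (norm (power_series ?d \<zeta>))\<^sup>2) \<le> \<eta>"
      by (rule sums_le[OF le parseval_power_series[OF sd] \<eta>_sums])
    moreover have "(\<integral>\<^sup>+\<zeta>. ennreal ((norm (power_series ?d \<zeta>))\<^sup>2) \<partial>circle_measure) =
        ennreal (LINT \<zeta>|circle_measure. (norm (power_series ?d \<zeta>))\<^sup>2)"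
      by (intro nn_integral_eq_integral circle_integrable_continuous continuous_on_power continuous_on_norm
          continuous_on_subset[OF continuous_power_series[OF sd]]) auto
    moreover have "(\<integral>\<^sup>+\<zeta>. ennreal ((norm (?F (of_real (radius j) * \<zeta>) - ?F (of_real (radius k) * \<zeta>)))\<^sup>2) \<partial>circle_measure) =
        (\<integral>\<^sup>+\<zeta>. ennreal ((norm (power_series ?d \<zeta>))\<^sup>2) \<partial>circle_measure)"
      by (rule nn_integral_cong) (simp add: pd)
    ultimately show ?thesis by (simp add: ennreal_leI)
  qed
  have "(\<integral>\<^sup>+\<zeta>. ennreal ((norm (?b \<zeta> - ?F (of_real (radius k) * \<zeta>)))\<^sup>2) \<partial>circle_measure) =
      (\<integral>\<^sup>+\<zeta>. liminf (\<lambda>j. ennreal ((norm (?F (of_real (radius j) * \<zeta>) - ?F (of_real (radius k) * \<zeta>)))\<^sup>2)) \<partial>circle_measure)"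
  proof (rule nn_integral_cong_AE)
    show "AE \<zeta> in circle_measure. ennreal ((norm (?b \<zeta> - ?F (of_real (radius k) * \<zeta>)))\<^sup>2) =
        liminf (\<lambda>j. ennreal ((norm (?F (of_real (radius j) * \<zeta>) - ?F (of_real (radius k) * \<zeta>)))\<^sup>2))"
      using boundary_fun_tendsto_AE[OF c]
    proof eventually_elim
      case (elim \<zeta>)
      have "(\<lambda>j. ennreal ((norm (?F (of_real (radius j) * \<zeta>) - ?F (of_real (radius k) * \<zeta>)))\<^sup>2)) \<longlonglongrightarrow>
          ennreal ((norm (?b \<zeta> - ?F (of_real (radius k) * \<zeta>)))\<^sup>2)"
        by (intro tendsto_ennrealI tendsto_power tendsto_norm tendsto_diff elim tendsto_const)
      then show ?case by (rule lim_imp_Liminf[OF trivial_limit_sequentially, symmetric])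
    qed
  qed
  also have "\<dots> \<le> liminf (\<lambda>j. \<integral>\<^sup>+\<zeta>. ennreal ((norm (?F (of_real (radius j) * \<zeta>) - ?F (of_real (radius k) * \<zeta>)))\<^sup>2) \<partial>circle_measure)"
    by (rule nn_integral_liminf) measurable
  also have "\<dots> \<le> ennreal \<eta>"
    by (rule Liminf_le) (auto simp: eventually_sequentially intro!: exI[of _ k] step)
  finally have nn: "(\<integral>\<^sup>+\<zeta>. ennreal ((norm (?b \<zeta> - ?F (of_real (radius k) * \<zeta>)))\<^sup>2) \<partial>circle_measure) \<le> ennreal \<eta>" .
  show int: "integrable circle_measure (\<lambda>\<zeta>. (norm (?b \<zeta> - ?F (of_real (radius k) * \<zeta>)))\<^sup>2)"
  proof (rule integrableI_nonneg)
    show "(\<lambda>\<zeta>. (norm (?b \<zeta> - ?F (of_real (radius k) * \<zeta>)))\<^sup>2) \<in> borel_measurable circle_measure"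
      by measurable
    show "(\<integral>\<^sup>+\<zeta>. ennreal ((norm (?b \<zeta> - ?F (of_real (radius k) * \<zeta>)))\<^sup>2) \<partial>circle_measure) < \<infinity>"
      using nn le_less_trans by fastforce
  qed auto
  show "(LINT \<zeta>|circle_measure. (norm (?b \<zeta> - ?F (of_real (radius k) * \<zeta>)))\<^sup>2) \<le> (\<Sum>n. (norm (c n))\<^sup>2 * (1 - radius k ^ n)\<^sup>2)"
    using nn nn_integral_eq_integral[OF int] \<eta>_nonneg unfolding \<eta>_def[symmetric] by simp
qed

lemma L2_circle_integrable: "f \<in> L2_circle \<Longrightarrow> integrable circle_measure f"
proof -
  assume f: "f \<in> L2_circle"
  show "integrable circle_measure f"
  proof (rule Bochner_Integration.integrable_bound)
    show "integrable circle_measure (\<lambda>\<zeta>. 1 + (norm (f \<zeta>))\<^sup>2)" using f by (simp add: L2_circle_def)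
    show "f \<in> borel_measurable circle_measure" using f by (simp add: L2_circle_def)
    have "x \<le> 1 + x\<^sup>2" for x :: real
    proof -
      have "2 * x \<le> x\<^sup>2 + 1" using sum_squares_bound[of x 1] by simp
      then show ?thesis using zero_le_power2[of x] by linarith
    qed
    then show "AE \<zeta> in circle_measure. norm (f \<zeta>) \<le> norm (1 + (norm (f \<zeta>))\<^sup>2)" by simp
  qed
qed

lemma L2_circle_mult_integrable:
  assumes f: "f \<in> L2_circle" and g: "g \<in> L2_circle"
  shows "integrable circle_measure (\<lambda>\<zeta>. f \<zeta> * g \<zeta>)"
proof (rule Bochner_Integration.integrable_bound)
  show "integrable circle_measure (\<lambda>\<zeta>. (norm (f \<zeta>))\<^sup>2 + (norm (g \<zeta>))\<^sup>2)" using assms by (simp add: L2_circle_def)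
  show "(\<lambda>\<zeta>. f \<zeta> * g \<zeta>) \<in> borel_measurable circle_measure" using assms by (auto simp: L2_circle_def)
  have "norm (f \<zeta> * g \<zeta>) \<le> norm ((norm (f \<zeta>))\<^sup>2 + (norm (g \<zeta>))\<^sup>2)" for \<zeta>
  proof -
    have "2 * norm (f \<zeta>) * norm (g \<zeta>) \<le> (norm (f \<zeta>))\<^sup>2 + (norm (g \<zeta>))\<^sup>2" by (rule sum_squares_bound)
    moreover have "0 \<le> norm (f \<zeta>) * norm (g \<zeta>)" by simp
    moreover have "norm ((norm (f \<zeta>))\<^sup>2 + (norm (g \<zeta>))\<^sup>2) = (norm (f \<zeta>))\<^sup>2 + (norm (g \<zeta>))\<^sup>2" by simp
    ultimately show ?thesis unfolding norm_mult by linarith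
  qed
  then show "AE \<zeta> in circle_measure. norm (f \<zeta> * g \<zeta>) \<le> norm ((norm (f \<zeta>))\<^sup>2 + (norm (g \<zeta>))\<^sup>2)" by simp
qed

lemma L2_circle_add:
  assumes f: "f \<in> L2_circle" and g: "g \<in> L2_circle"
  shows "(\<lambda>\<zeta>. f \<zeta> + g \<zeta>) \<in> L2_circle"
proof -
  have "integrable circle_measure (\<lambda>\<zeta>. (norm (f \<zeta> + g \<zeta>))\<^sup>2)"
  proof (rule Bochner_Integration.integrable_bound)
    show "integrable circle_measure (\<lambda>\<zeta>. 2 * (norm (f \<zeta>))\<^sup>2 + 2 * (norm (g \<zeta>))\<^sup>2)" using assms by (simp add: L2_circle_def)
    show "(\<lambda>\<zeta>. (norm (f \<zeta> + g \<zeta>))\<^sup>2) \<in> borel_measurable circle_measure"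
      using assms by (auto simp: L2_circle_def)
    have "(norm (f \<zeta> + g \<zeta>))\<^sup>2 \<le> 2 * (norm (f \<zeta>))\<^sup>2 + 2 * (norm (g \<zeta>))\<^sup>2" for \<zeta>
    proof -
      have "(norm (f \<zeta> + g \<zeta>))\<^sup>2 \<le> (norm (f \<zeta>) + norm (g \<zeta>))\<^sup>2" by (intro power_mono norm_triangle_ineq) simp
      also have "\<dots> \<le> 2 * (norm (f \<zeta>))\<^sup>2 + 2 * (norm (g \<zeta>))\<^sup>2"
        using sum_squares_bound[of "norm (f \<zeta>)" "norm (g \<zeta>)"] by (simp add: power2_sum)
      finally show ?thesis .
    qed
    then show "AE \<zeta> in circle_measure. norm ((norm (f \<zeta> + g \<zeta>))\<^sup>2) \<le> norm (2 * (norm (f \<zeta>))\<^sup>2 + 2 * (norm (g \<zeta>))\<^sup>2)"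
      by simp
  qed
  then show ?thesis using assms by (auto simp: L2_circle_def intro: borel_measurable_add)
qed

lemma L2_circle_cmult:
  assumes f: "f \<in> L2_circle"
  shows "(\<lambda>\<zeta>. a * f \<zeta>) \<in> L2_circle"
proof -
  have "(\<lambda>\<zeta>. a * f \<zeta>) \<in> borel_measurable circle_measure"
    by (rule borel_measurable_times[OF borel_measurable_const]) (use f in \<open>simp add: L2_circle_def\<close>)
  then show ?thesis using f by (simp add: L2_circle_def norm_mult power_mult_distrib)
qed

lemma L2_circle_cnj:
  assumes f: "f \<in> L2_circle"
  shows "(\<lambda>\<zeta>. cnj (f \<zeta>)) \<in> L2_circle"
proof -
  have "f \<in> borel_measurable circle_measure" using f by (simp add: L2_circle_def)
  moreover have "cnj \<in> borel_measurable borel"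
    by (intro borel_measurable_continuous_onI continuous_on_cnj continuous_on_id)
  ultimately have "(\<lambda>\<zeta>. cnj (f \<zeta>)) \<in> borel_measurable circle_measure"
    by (rule measurable_compose)
  then show ?thesis using f by (simp add: L2_circle_def)
qed

lemma L2_circle_diff:
  assumes "f \<in> L2_circle" "g \<in> L2_circle"
  shows "(\<lambda>\<zeta>. f \<zeta> - g \<zeta>) \<in> L2_circle"
  using L2_circle_add[OF assms(1) L2_circle_cmult[OF assms(2), of "-1"]] by simp

lemma L2_circle_continuous:
  assumes "continuous_on (sphere 0 1) f"
  shows "f \<in> L2_circle"
  unfolding L2_circle_def
  using measurable_circle_continuous[OF assms]
    circle_integrable_continuous[OF continuous_on_power[OF continuous_on_norm[OF assms]], of 2] by simp

text \<open>
  A weighted form of \<open>2 x y \<le> x\<^sup>2 + y\<^sup>2\<close> takes the place of the Cauchy-Schwarz inequality.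
\<close>

lemma L2_null_sequence_inner:
  assumes X: "\<And>k. X k \<in> L2_circle" and "(\<lambda>k. LINT \<zeta>|circle_measure. (norm (X k \<zeta>))\<^sup>2) \<longlonglongrightarrow> 0"
    and g: "g \<in> L2_circle"
  shows "(\<lambda>k. LINT \<zeta>|circle_measure. X k \<zeta> * g \<zeta>) \<longlonglongrightarrow> 0"
proof (rule tendstoI)
  fix e :: real assume e: "0 < e"
  define B where "B = (LINT \<zeta>|circle_measure. (norm (g \<zeta>))\<^sup>2)"
  have B: "0 \<le> B" unfolding B_def by (rule integral_nonneg_AE) simp
  \<comment> \<open>the weight makes the contribution of \<open>g\<close> at most \<open>e / 2\<close>\<close>
  define \<delta> where "\<delta> = e / (2 * (B + 1))"
  have \<delta>: "0 < \<delta>" using e B by (simp add: \<delta>_def)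
  have iX: "integrable circle_measure (\<lambda>\<zeta>. (norm (X k \<zeta>))\<^sup>2)" for k using X by (simp add: L2_circle_def)
  have ig: "integrable circle_measure (\<lambda>\<zeta>. (norm (g \<zeta>))\<^sup>2)" using g by (simp add: L2_circle_def)
  have bound: "norm (LINT \<zeta>|circle_measure. X k \<zeta> * g \<zeta>) \<le> (LINT \<zeta>|circle_measure. (norm (X k \<zeta>))\<^sup>2) / \<delta> + \<delta> * B" for k
  proof -
    have "norm (LINT \<zeta>|circle_measure. X k \<zeta> * g \<zeta>) \<le> (LINT \<zeta>|circle_measure. norm (X k \<zeta> * g \<zeta>))"
      by (rule integral_norm_bound)
    also have "\<dots> \<le> (LINT \<zeta>|circle_measure. (norm (X k \<zeta>))\<^sup>2 / \<delta> + \<delta> * (norm (g \<zeta>))\<^sup>2)"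
    proof (rule integral_mono)
      show "integrable circle_measure (\<lambda>\<zeta>. norm (X k \<zeta> * g \<zeta>))"
        using L2_circle_mult_integrable[OF X g] by (rule integrable_norm)
      show "integrable circle_measure (\<lambda>\<zeta>. (norm (X k \<zeta>))\<^sup>2 / \<delta> + \<delta> * (norm (g \<zeta>))\<^sup>2)"
        using iX ig by simp
      fix \<zeta>
      define x y where "x = norm (X k \<zeta>)" and "y = norm (g \<zeta>)"
      have xy: "0 \<le> x" "0 \<le> y" by (simp_all add: x_def y_def)
      have "2 * x * (\<delta> * y) \<le> x\<^sup>2 + (\<delta> * y)\<^sup>2" by (rule sum_squares_bound)
      moreover have "0 \<le> x * (\<delta> * y)" using xy \<delta> by simp
      ultimately have "x * (\<delta> * y) \<le> x\<^sup>2 + (\<delta> * y)\<^sup>2" by linarith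
      then have "x * y \<le> x\<^sup>2 / \<delta> + \<delta> * y\<^sup>2" using \<delta> by (simp add: field_simps power2_eq_square)
      then show "norm (X k \<zeta> * g \<zeta>) \<le> (norm (X k \<zeta>))\<^sup>2 / \<delta> + \<delta> * (norm (g \<zeta>))\<^sup>2"
        by (simp add: x_def y_def norm_mult)
    qed
    also have "\<dots> = (LINT \<zeta>|circle_measure. (norm (X k \<zeta>))\<^sup>2) / \<delta> + \<delta> * B"
      using iX ig by (simp add: B_def)
    finally show ?thesis .
  qed
  have "\<delta> * B < e"
  proof -
    have "\<delta> * B \<le> \<delta> * (B + 1)" using \<delta> by simp
    also have "\<dots> = e / 2" using B by (simp add: \<delta>_def field_simps)
    finally show ?thesis using e by simp
  qed
  moreover have "(\<lambda>k. (LINT \<zeta>|circle_measure. (norm (X k \<zeta>))\<^sup>2) / \<delta> + \<delta> * B) \<longlonglongrightarrow> 0 / \<delta> + \<delta> * B"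
    using \<delta> by (intro tendsto_intros assms) auto
  ultimately have "\<forall>\<^sub>F k in sequentially. (LINT \<zeta>|circle_measure. (norm (X k \<zeta>))\<^sup>2) / \<delta> + \<delta> * B < e"
    by (intro order_tendstoD) auto
  then show "\<forall>\<^sub>F k in sequentially. dist (LINT \<zeta>|circle_measure. X k \<zeta> * g \<zeta>) 0 < e"
  proof eventually_elim
    case (elim k)
    with bound[of k] show ?case by simp
  qed
qed

lemma boundary_fun_cong:
  assumes "\<And>z. norm z < 1 \<Longrightarrow> f z = g z" and \<zeta>: "\<zeta> \<in> sphere 0 1"
  shows "boundary_fun f \<zeta> = boundary_fun g \<zeta>"
proof -
  have "\<forall>\<^sub>F r in at_left (1::real). f (of_real r * \<zeta>) = g (of_real r * \<zeta>)"
    by (rule eventually_at_leftI[of 0]) (use \<zeta> in \<open>auto intro!: assms(1) simp: norm_mult\<close>)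
  then have "((\<lambda>r. f (of_real r * \<zeta>)) \<longlongrightarrow> l) (at_left 1) \<longleftrightarrow> ((\<lambda>r. g (of_real r * \<zeta>)) \<longlongrightarrow> l) (at_left 1)" for l
    by (rule tendsto_cong)
  then show ?thesis by (simp add: boundary_fun_def Topological_Spaces.Lim_def)
qed

lemma boundary_fun_in_L2:
  assumes c: "summable (\<lambda>n. (norm (c n))\<^sup>2)"
  shows "boundary_fun (power_series c) \<in> L2_circle"
    and "(\<lambda>\<zeta>. boundary_fun (power_series c) \<zeta> - power_series c (of_real (radius k) * \<zeta>)) \<in> L2_circle"
proof -
  let ?F = "\<lambda>k \<zeta>. power_series c (of_real (radius k) * \<zeta>)" and ?b = "boundary_fun (power_series c)"
  have F: "?F k \<in> L2_circle" for k
    by (intro L2_circle_continuous continuous_on_subset[OF continuous_power_series_dilation[OF c]])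
      (use radius_bounds[of k] in auto)
  have d: "(\<lambda>\<zeta>. ?b \<zeta> - ?F k \<zeta>) \<in> L2_circle" for k
  proof -
    have "?F k \<in> borel_measurable circle_measure" using F[of k] by (simp add: L2_circle_def)
    then have "(\<lambda>\<zeta>. ?b \<zeta> - ?F k \<zeta>) \<in> borel_measurable circle_measure"
      by (rule borel_measurable_diff[OF measurable_boundary_fun[OF c]])
    then show ?thesis using boundary_fun_L2_approx(1)[OF c, of k] by (simp add: L2_circle_def)
  qed
  show "(\<lambda>\<zeta>. ?b \<zeta> - ?F k \<zeta>) \<in> L2_circle" by (rule d)
  show "?b \<in> L2_circle" using L2_circle_add[OF d[of 0] F[of 0]] by simp
qed

lemma boundary_fun_L2_tendsto:
  assumes c: "summable (\<lambda>n. (norm (c n))\<^sup>2)"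
  shows "(\<lambda>k. LINT \<zeta>|circle_measure. (norm (boundary_fun (power_series c) \<zeta> - power_series c (of_real (radius k) * \<zeta>)))\<^sup>2) \<longlonglongrightarrow> 0"
proof (rule tendsto_sandwich[OF _ _ tendsto_const l2_dilation_tendsto[OF c]])
  show "\<forall>\<^sub>F k in sequentially. 0 \<le> (LINT \<zeta>|circle_measure. (norm (boundary_fun (power_series c) \<zeta> - power_series c (of_real (radius k) * \<zeta>)))\<^sup>2)"
    by (intro always_eventually allI integral_nonneg_AE) simp
  show "\<forall>\<^sub>F k in sequentially. (LINT \<zeta>|circle_measure. (norm (boundary_fun (power_series c) \<zeta> - power_series c (of_real (radius k) * \<zeta>)))\<^sup>2)
      \<le> (\<Sum>n. (norm (c n))\<^sup>2 * (1 - radius k ^ n)\<^sup>2)"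
    by (intro always_eventually allI boundary_fun_L2_approx(2)[OF c])
qed

text \<open>
  The dilates converge weakly to the boundary function, which therefore inherits every linear relation that
  they satisfy: the Fourier coefficients, the vanishing of those of negative index, and orthogonality
  relations.
\<close>

lemma boundary_fun_integral_tendsto:
  assumes c: "summable (\<lambda>n. (norm (c n))\<^sup>2)" and g: "g \<in> L2_circle"
  shows "(\<lambda>k. LINT \<zeta>|circle_measure. power_series c (of_real (radius k) * \<zeta>) * g \<zeta>) \<longlonglongrightarrow>
    (LINT \<zeta>|circle_measure. boundary_fun (power_series c) \<zeta> * g \<zeta>)"
proof -
  let ?F = "\<lambda>k \<zeta>. power_series c (of_real (radius k) * \<zeta>)" and ?b = "boundary_fun (power_series c)"
  have "(\<lambda>k. LINT \<zeta>|circle_measure. (?b \<zeta> - ?F k \<zeta>) * g \<zeta>) \<longlonglongrightarrow> 0"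
    by (rule L2_null_sequence_inner[OF boundary_fun_in_L2(2)[OF c] boundary_fun_L2_tendsto[OF c] g])
  from tendsto_diff[OF tendsto_const[of "LINT \<zeta>|circle_measure. ?b \<zeta> * g \<zeta>"] this]
  have *: "(\<lambda>k. (LINT \<zeta>|circle_measure. ?b \<zeta> * g \<zeta>) - (LINT \<zeta>|circle_measure. (?b \<zeta> - ?F k \<zeta>) * g \<zeta>)) \<longlonglongrightarrow>
      (LINT \<zeta>|circle_measure. ?b \<zeta> * g \<zeta>)" by simp
  have "(LINT \<zeta>|circle_measure. ?b \<zeta> * g \<zeta>) - (LINT \<zeta>|circle_measure. (?b \<zeta> - ?F k \<zeta>) * g \<zeta>) =
      (LINT \<zeta>|circle_measure. ?F k \<zeta> * g \<zeta>)" for k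
  proof -
    have "(LINT \<zeta>|circle_measure. ?b \<zeta> * g \<zeta>) - (LINT \<zeta>|circle_measure. (?b \<zeta> - ?F k \<zeta>) * g \<zeta>) =
        (LINT \<zeta>|circle_measure. ?b \<zeta> * g \<zeta> - (?b \<zeta> - ?F k \<zeta>) * g \<zeta>)"
      by (rule Bochner_Integration.integral_diff[symmetric])
        (intro L2_circle_mult_integrable boundary_fun_in_L2[OF c] g)+
    then show ?thesis by (simp add: algebra_simps)
  qed
  with * show ?thesis by simp
qed

lemma fourier_coeff_boundary_fun:
  assumes c: "summable (\<lambda>n. (norm (c n))\<^sup>2)"
  shows "fourier_coeff (boundary_fun (power_series c)) n = c n"
    and "n > 0 \<Longrightarrow> (LINT \<zeta>|circle_measure. boundary_fun (power_series c) \<zeta> * \<zeta> ^ n) = 0"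
proof -
  have s: "summable (\<lambda>n. norm (c n * of_real (radius k) ^ n))" for k
    by (rule summable_l2_dilation[OF c]) (use radius_bounds[of k] in auto)
  have "fourier_coeff (power_series (\<lambda>n. c n * of_real (radius k) ^ n)) n = c n * of_real (radius k) ^ n" for k
    by (rule fourier_coeff_power_series[OF s])
  moreover have "(\<lambda>k. fourier_coeff (power_series (\<lambda>n. c n * of_real (radius k) ^ n)) n) \<longlonglongrightarrow> fourier_coeff (boundary_fun (power_series c)) n"
    unfolding fourier_coeff_def power_series_dilation
    by (rule boundary_fun_integral_tendsto[OF c]) (intro L2_circle_continuous continuous_on_cnj continuous_on_power continuous_on_id)
  moreover have "(\<lambda>k. c n * of_real (radius k) ^ n) \<longlonglongrightarrow> c n * of_real 1 ^ n"
    by (intro tendsto_mult tendsto_const tendsto_power tendsto_of_real radius_tendsto)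
  ultimately show "fourier_coeff (boundary_fun (power_series c)) n = c n"
    using LIMSEQ_unique by simp
  assume n: "n > 0"
  have "(LINT \<zeta>|circle_measure. power_series c (of_real (radius k) * \<zeta>) * \<zeta> ^ n) = 0" for k
    using integral_power_series_monomial[OF s[of k] n] by (simp add: power_series_dilation)
  moreover have "(\<lambda>k. LINT \<zeta>|circle_measure. power_series c (of_real (radius k) * \<zeta>) * \<zeta> ^ n) \<longlonglongrightarrow>
      (LINT \<zeta>|circle_measure. boundary_fun (power_series c) \<zeta> * \<zeta> ^ n)"
    by (rule boundary_fun_integral_tendsto[OF c]) (intro L2_circle_continuous continuous_on_power continuous_on_id)
  ultimately show "(LINT \<zeta>|circle_measure. boundary_fun (power_series c) \<zeta> * \<zeta> ^ n) = 0"
    by (simp add: LIMSEQ_const_iff)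
qed

lemma poisson_ext_boundary_fun:
  assumes c: "summable (\<lambda>n. (norm (c n))\<^sup>2)" and z: "norm z < 1"
  shows "poisson_ext (boundary_fun (power_series c)) z = power_series c z"
proof -
  have "fourier_coeff (boundary_fun (power_series c)) = c"
    using fourier_coeff_boundary_fun(1)[OF c] by (rule ext)
  then show ?thesis
    using poisson_ext_analytic[OF L2_circle_integrable[OF boundary_fun_in_L2(1)[OF c]] z fourier_coeff_boundary_fun(2)[OF c]]
    by simp
qed

text \<open>
  Boundary functions are limits of absolutely convergent power series, so they are orthogonal to every
  function without Fourier coefficients of nonnegative index.
\<close>

lemma L2_inner_boundary_fun_eq_0:
  assumes c: "summable (\<lambda>n. (norm (c n))\<^sup>2)" and g: "g \<in> L2_circle"
    and 0: "\<And>n. fourier_coeff g n = 0"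
  shows "L2_inner g (boundary_fun (power_series c)) = 0"
proof -
  have s: "summable (\<lambda>n. norm (c n * of_real (radius k) ^ n))" for k
    by (rule summable_l2_dilation[OF c]) (use radius_bounds[of k] in auto)
  have "(LINT \<zeta>|circle_measure. power_series c (of_real (radius k) * \<zeta>) * cnj (g \<zeta>)) = 0" for k
  proof -
    have "(LINT \<zeta>|circle_measure. g \<zeta> * cnj (power_series c (of_real (radius k) * \<zeta>))) = 0"
      using inner_power_series[OF L2_circle_integrable[OF g] s[of k]]
      by (simp add: 0 power_series_dilation sums_iff)
    then have "cnj (LINT \<zeta>|circle_measure. g \<zeta> * cnj (power_series c (of_real (radius k) * \<zeta>))) = 0" by simp
    then show ?thesis
      unfolding circle_integral_cnj[symmetric] by (simp del: Bochner_Integration.integral_cnj add: mult.commute)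
  qed
  moreover have "(\<lambda>k. LINT \<zeta>|circle_measure. power_series c (of_real (radius k) * \<zeta>) * cnj (g \<zeta>)) \<longlonglongrightarrow>
      (LINT \<zeta>|circle_measure. boundary_fun (power_series c) \<zeta> * cnj (g \<zeta>))"
    by (rule boundary_fun_integral_tendsto[OF c L2_circle_cnj[OF g]])
  ultimately have "(LINT \<zeta>|circle_measure. boundary_fun (power_series c) \<zeta> * cnj (g \<zeta>)) = 0"
    by (simp add: LIMSEQ_const_iff)
  then have "cnj (LINT \<zeta>|circle_measure. boundary_fun (power_series c) \<zeta> * cnj (g \<zeta>)) = 0" by simp
  then show ?thesis
    unfolding L2_inner_def circle_integral_cnj[symmetric] by (simp del: Bochner_Integration.integral_cnj add: mult.commute)
qed

section \<open>The Hardy space\<close>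

text \<open>
  Parseval on the circles of radius less than \<open>1\<close> bounds each partial sum by the supremum of the
  integral means.
\<close>

lemma hardy_space_l2:
  assumes f: "f \<in> hardy_space" and c: "\<And>z. norm z < 1 \<Longrightarrow> (\<lambda>n. c n * z ^ n) sums f z"
  shows "summable (\<lambda>n. (norm (c n))\<^sup>2)"
proof -
  have ps: "f z = power_series c z" if "norm z < 1" for z
    using c[OF that] by (simp add: power_series_def sums_iff)
  obtain B where B: "\<And>r. 0 \<le> r \<Longrightarrow> r < 1 \<Longrightarrow> (LINT \<zeta>|circle_measure. (norm (f (of_real r * \<zeta>)))\<^sup>2) \<le> B"
  proof -
    have "bdd_above ((\<lambda>r. LINT \<zeta>|circle_measure. (norm (f (of_real r * \<zeta>)))\<^sup>2) ` {0..<1})"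
      using f by (simp add: hardy_space_def)
    then obtain B where "\<forall>x\<in>(\<lambda>r. LINT \<zeta>|circle_measure. (norm (f (of_real r * \<zeta>)))\<^sup>2) ` {0..<1}. x \<le> B"
      unfolding bdd_above_def by blast
    then show ?thesis by (intro that[of B]) (simp add: image_iff)
  qed
  have "(\<Sum>i<N. (norm (c i))\<^sup>2) \<le> B" for N
  proof (rule LIMSEQ_le_const2)
    have "(\<lambda>k. \<Sum>i<N. (norm (c i))\<^sup>2 * (radius k ^ i)\<^sup>2) \<longlonglongrightarrow> (\<Sum>i<N. (norm (c i))\<^sup>2 * (1 ^ i)\<^sup>2)"
      by (intro tendsto_intros radius_tendsto)
    then show "(\<lambda>k. \<Sum>i<N. (norm (c i))\<^sup>2 * (radius k ^ i)\<^sup>2) \<longlonglongrightarrow> (\<Sum>i<N. (norm (c i))\<^sup>2)" by simp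
    have "(\<Sum>i<N. (norm (c i))\<^sup>2 * (radius k ^ i)\<^sup>2) \<le> B" for k
    proof -
      have r: "0 \<le> radius k" "radius k < 1" using radius_bounds[of k] by auto
      have s: "summable (\<lambda>n. norm (c n * of_real (radius k) ^ n))"
        using c by (intro power_series_summable_disk r) (auto simp: sums_iff)
      have "(\<lambda>n. (norm (c n))\<^sup>2 * (radius k ^ n)\<^sup>2) sums
          (LINT \<zeta>|circle_measure. (norm (power_series c (of_real (radius k) * \<zeta>)))\<^sup>2)"
        using parseval_power_series[OF s] r
        by (simp add: power_series_dilation norm_mult norm_power power_mult_distrib)
      moreover have "(LINT \<zeta>|circle_measure. (norm (power_series c (of_real (radius k) * \<zeta>)))\<^sup>2) =
          (LINT \<zeta>|circle_measure. (norm (f (of_real (radius k) * \<zeta>)))\<^sup>2)"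
        by (rule Bochner_Integration.integral_cong[OF refl]) (use r in \<open>simp add: ps norm_mult\<close>)
      ultimately have "(\<lambda>n. (norm (c n))\<^sup>2 * (radius k ^ n)\<^sup>2) sums (LINT \<zeta>|circle_measure. (norm (f (of_real (radius k) * \<zeta>)))\<^sup>2)"
        by simp
      then have "(\<Sum>i<N. (norm (c i))\<^sup>2 * (radius k ^ i)\<^sup>2) \<le> (LINT \<zeta>|circle_measure. (norm (f (of_real (radius k) * \<zeta>)))\<^sup>2)"
        using sum_le_suminf[of "\<lambda>n. (norm (c n))\<^sup>2 * (radius k ^ n)\<^sup>2" "{..<N}"] by (simp add: sums_iff)
      also have "\<dots> \<le> B" by (rule B[OF r])
      finally show ?thesis .
    qed
    then show "\<exists>K. \<forall>k\<ge>K. (\<Sum>i<N. (norm (c i))\<^sup>2 * (radius k ^ i)\<^sup>2) \<le> B" by blast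
  qed
  then show ?thesis by (intro summableI_nonneg_bounded) auto
qed

lemma holomorphic_taylor:
  assumes "f holomorphic_on unit_disk"
  shows "\<exists>c. \<forall>z. norm z < 1 \<longrightarrow> (\<lambda>n. c n * z ^ n) sums f z"
  using holomorphic_power_series[OF assms] by (intro exI[of _ "\<lambda>n. (deriv ^^ n) f 0 / fact n"]) auto

text \<open>
  The facts about boundary functions of power series, carried over to the members of the Hardy space. A
  function on the disk agrees with its power series only there, so the boundary functions are compared on
  the circle and every integral is rewritten by congruence.
\<close>

lemma hardy_boundary_fun:
  assumes f: "f \<in> hardy_space" and c: "\<And>z. norm z < 1 \<Longrightarrow> (\<lambda>n. c n * z ^ n) sums f z"
  shows "boundary_fun f \<in> L2_circle"
    and "fourier_coeff (boundary_fun f) n = c n"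
    and "norm z < 1 \<Longrightarrow> poisson_ext (boundary_fun f) z = f z"
    and "g \<in> L2_circle \<Longrightarrow> (\<And>n. fourier_coeff g n = 0) \<Longrightarrow> L2_inner g (boundary_fun f) = 0"
proof -
  let ?b = "boundary_fun (power_series c)"
  note l2 = hardy_space_l2[OF f c]
  have ps: "f z = power_series c z" if "norm z < 1" for z
    using c[OF that] by (simp add: power_series_def sums_iff)
  have eq: "boundary_fun f \<zeta> = ?b \<zeta>" if "\<zeta> \<in> space circle_measure" for \<zeta>
    by (rule boundary_fun_cong[of f "power_series c"]) (use ps that in simp_all)
  have "(LINT \<zeta>|circle_measure. h \<zeta> (boundary_fun f \<zeta>)) = (LINT \<zeta>|circle_measure. h \<zeta> (?b \<zeta>))" for h :: "complex \<Rightarrow> complex \<Rightarrow> complex"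
    by (rule Bochner_Integration.integral_cong[OF refl]) (simp add: eq)
  note int_eq = this
  show "boundary_fun f \<in> L2_circle"
  proof -
    have "boundary_fun f \<in> borel_measurable circle_measure \<longleftrightarrow> ?b \<in> borel_measurable circle_measure"
      by (rule measurable_cong[OF eq])
    moreover have "integrable circle_measure (\<lambda>\<zeta>. (norm (boundary_fun f \<zeta>))\<^sup>2) \<longleftrightarrow> integrable circle_measure (\<lambda>\<zeta>. (norm (?b \<zeta>))\<^sup>2)"
      by (rule Bochner_Integration.integrable_cong[OF refl]) (simp add: eq)
    ultimately show ?thesis using boundary_fun_in_L2(1)[OF l2] by (simp add: L2_circle_def)
  qed
  show "fourier_coeff (boundary_fun f) n = c n"
    using fourier_coeff_boundary_fun(1)[OF l2, of n] int_eq[of "\<lambda>\<zeta> w. w * cnj (\<zeta> ^ n)"]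
    by (simp add: fourier_coeff_def)
  show "poisson_ext (boundary_fun f) z = f z" if z: "norm z < 1"
    using poisson_ext_boundary_fun[OF l2 z] int_eq[of "\<lambda>\<zeta> w. of_real (poisson_kernel z \<zeta>) * w"] ps[OF z]
    by (simp add: poisson_ext_kernel)
  show "L2_inner g (boundary_fun f) = 0" if "g \<in> L2_circle" "\<And>n. fourier_coeff g n = 0"
    using L2_inner_boundary_fun_eq_0[OF l2 that] int_eq[of "\<lambda>\<zeta> w. g \<zeta> * cnj w"]
    by (simp add: L2_inner_def)
qed

section \<open>Weighted Dirichlet spaces and the reproducing kernel\<close>

lemma wirtinger_harmonic:
  assumes f: "f holomorphic_on unit_disk" and h: "h holomorphic_on unit_disk" and z: "z \<in> unit_disk"
    and u: "\<And>w. w \<in> unit_disk \<Longrightarrow> u w = f w + cnj (h w)"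
  shows "d_z u z = deriv f z" "d_zbar u z = cnj (deriv h z)"
proof -
  have "(f has_derivative (\<lambda>x. deriv f z * x)) (at z)" "(h has_derivative (\<lambda>x. deriv h z * x)) (at z)"
    using holomorphic_derivI[OF f open_ball z] holomorphic_derivI[OF h open_ball z]
    by (simp_all add: has_field_derivative_def)
  then have "((\<lambda>w. f w + cnj (h w)) has_derivative (\<lambda>x. deriv f z * x + cnj (deriv h z * x))) (at z)"
    by (intro has_derivative_add has_derivative_cnj)
  then have "(u has_derivative (\<lambda>x. deriv f z * x + cnj (deriv h z * x))) (at z)"
    by (rule has_derivative_transform_within_open[OF _ open_ball z]) (simp add: u)
  then have "frechet_derivative u (at z) = (\<lambda>x. deriv f z * x + cnj (deriv h z * x))"
    using frechet_derivative_at by metis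
  then show "d_z u z = deriv f z" "d_zbar u z = cnj (deriv h z)"
    by (simp_all add: d_z_def d_zbar_def algebra_simps)
qed

lemma space_area [simp]: "space area_measure = unit_disk"
  by (simp add: area_measure_def space_restrict_space)

lemma holomorphic_fourier_power_series:
  assumes u: "u \<in> L2_circle"
  shows "power_series (fourier_coeff u) holomorphic_on unit_disk"
  by (rule power_series_holomorphic[of _ _ "fourier_coeff u"])
    (use szego_projection_sums[OF L2_circle_integrable[OF u]] in \<open>simp add: power_series_def sums_iff\<close>)

text \<open>
  The holomorphic part of the Poisson extension is the Szego projection.
\<close>

lemma d_z_poisson_ext:
  assumes u: "u \<in> L2_circle" and z: "z \<in> unit_disk"
  shows "d_z (poisson_ext u) z = deriv (power_series (fourier_coeff u)) z"
proof -
  have "(\<lambda>w. power_series (fourier_coeff (\<lambda>\<zeta>. cnj (u \<zeta>))) w - cnj (fourier_coeff u 0)) holomorphic_on unit_disk"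
    by (intro holomorphic_on_diff holomorphic_fourier_power_series L2_circle_cnj u holomorphic_on_const)
  then show ?thesis
    by (rule wirtinger_harmonic(1)[OF holomorphic_fourier_power_series[OF u] _ z])
      (simp add: poisson_ext_szego[OF L2_circle_integrable[OF u]])
qed

lemma wirtinger_boundary_fun:
  assumes f: "f \<in> hardy_space" and z: "z \<in> unit_disk"
  shows "d_z (poisson_ext (boundary_fun f)) z = deriv f z" "d_zbar (poisson_ext (boundary_fun f)) z = 0"
proof -
  have hol: "f holomorphic_on unit_disk" using f by (simp add: hardy_space_def)
  obtain c where c: "\<And>z. norm z < 1 \<Longrightarrow> (\<lambda>n. c n * z ^ n) sums f z" using holomorphic_taylor[OF hol] by blast
  have eq: "poisson_ext (boundary_fun f) w = f w + cnj 0" if "w \<in> unit_disk" for w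
    using hardy_boundary_fun(3)[OF f c, of w] that by simp
  show "d_z (poisson_ext (boundary_fun f)) z = deriv f z" "d_zbar (poisson_ext (boundary_fun f)) z = 0"
    using wirtinger_harmonic[OF hol holomorphic_on_const z eq] by simp_all
qed

text \<open>
  The Poisson extension of the boundary function is the function itself, so the two energies have the same
  integrand.
\<close>

lemma boundary_fun_in_harmonic_dirichlet_space:
  assumes f: "f \<in> dirichlet_space \<omega>" "f \<in> hardy_space"
  shows "boundary_fun f \<in> harmonic_dirichlet_space \<omega>"
proof -
  have hol: "f holomorphic_on unit_disk" using f by (simp add: hardy_space_def)
  obtain c where c: "\<And>z. norm z < 1 \<Longrightarrow> (\<lambda>n. c n * z ^ n) sums f z" using holomorphic_taylor[OF hol] by blast
  have "(\<integral>\<^sup>+z. ennreal ((norm (d_z (poisson_ext (boundary_fun f)) z))\<^sup>2 + (norm (d_zbar (poisson_ext (boundary_fun f)) z))\<^sup>2) * \<omega> z \<partial>area_measure) =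
      (\<integral>\<^sup>+z. ennreal ((norm (deriv f z))\<^sup>2) * \<omega> z \<partial>area_measure)"
    by (rule nn_integral_cong) (simp add: wirtinger_boundary_fun[OF f(2)])
  then show ?thesis
    using f(1) hardy_boundary_fun(1)[OF f(2) c] by (simp add: harmonic_dirichlet_space_def dirichlet_space_def)
qed

text \<open>
  The derivative of the analytic part contributes one of the two nonnegative terms of the energy density.
\<close>

lemma analytic_part_in_dirichlet_space:
  assumes u: "u \<in> harmonic_dirichlet_space \<omega>"
  shows "power_series (fourier_coeff u) \<in> dirichlet_space \<omega>"
proof -
  have L2: "u \<in> L2_circle" using u by (simp add: harmonic_dirichlet_space_def)
  have "(\<integral>\<^sup>+z. ennreal ((norm (deriv (power_series (fourier_coeff u)) z))\<^sup>2) * \<omega> z \<partial>area_measure) \<le>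
      (\<integral>\<^sup>+z. ennreal ((norm (d_z (poisson_ext u) z))\<^sup>2 + (norm (d_zbar (poisson_ext u) z))\<^sup>2) * \<omega> z \<partial>area_measure)"
    by (rule nn_integral_mono) (auto intro!: mult_right_mono ennreal_leI simp: d_z_poisson_ext[OF L2])
  also have "\<dots> < \<infinity>" using u by (simp add: harmonic_dirichlet_space_def)
  finally show ?thesis
    using holomorphic_fourier_power_series[OF L2] by (simp add: dirichlet_space_def)
qed

theorem corollary3p1:
  fixes \<omega> :: "complex \<Rightarrow> ennreal"
    and k :: "complex \<Rightarrow> complex \<Rightarrow> complex"
    and G :: L2_graph
    and z :: complex
  assumes "superharmonic_weight \<omega>"
    and "dirichlet_space \<omega> \<subseteq> hardy_space"
    and "reproducing_kernel \<omega> k"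
    and "associated_operator \<omega> G"
    and "z \<in> unit_disk"
  shows "((\<lambda>\<zeta>. szego_kernel \<zeta> z), boundary_fun (\<lambda>\<zeta>. k \<zeta> z)) \<in> resolvent G"
proof -
  define kz where "kz = (\<lambda>\<zeta>. k \<zeta> z)"
  define \<kappa> where "\<kappa> = boundary_fun kz"
  define S where "S = (\<lambda>\<zeta>. szego_kernel \<zeta> z)"
  have z: "norm z < 1" using assms(5) by simp
  have kz: "kz \<in> dirichlet_space \<omega>"
    and repr: "\<And>f. f \<in> dirichlet_space \<omega> \<Longrightarrow> f z = dirichlet_inner \<omega> f kz"
    using assms(3,5) by (auto simp: reproducing_kernel_def kz_def)
  have kz_hardy: "kz \<in> hardy_space" using kz assms(2) by blast
  have G: "Domain G \<subseteq> harmonic_dirichlet_space \<omega>" "adjoint_graph G = G"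
    "\<And>u v g. (u, v) \<in> G \<Longrightarrow> g \<in> harmonic_dirichlet_space \<omega> \<Longrightarrow> energy_form \<omega> u g = L2_inner v g"
    using assms(4) by (auto simp: associated_operator_def self_adjoint_operator_def)
  have \<kappa>_dom: "\<kappa> \<in> harmonic_dirichlet_space \<omega>"
    unfolding \<kappa>_def by (rule boundary_fun_in_harmonic_dirichlet_space[OF kz kz_hardy])
  then have \<kappa>: "\<kappa> \<in> L2_circle" by (simp add: harmonic_dirichlet_space_def)
  have S: "S \<in> L2_circle" unfolding S_def by (rule L2_circle_continuous[OF continuous_szego[OF z]])
  have h: "(\<lambda>\<zeta>. S \<zeta> - \<kappa> \<zeta>) \<in> L2_circle" by (rule L2_circle_diff[OF S \<kappa>])
  have "L2_inner v \<kappa> = L2_inner u (\<lambda>\<zeta>. S \<zeta> - \<kappa> \<zeta>)" if uv: "(u, v) \<in> G" for u v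
  proof -
    have u_dom: "u \<in> harmonic_dirichlet_space \<omega>" using G(1) uv by blast
    then have u: "u \<in> L2_circle" by (simp add: harmonic_dirichlet_space_def)
    define f where "f = power_series (fourier_coeff u)"
    have f: "f \<in> dirichlet_space \<omega>" unfolding f_def by (rule analytic_part_in_dirichlet_space[OF u_dom])
    then have f_hardy: "f \<in> hardy_space" using assms(2) by blast
    have f_sums: "(\<lambda>n. fourier_coeff u n * w ^ n) sums f w" if "norm w < 1" for w
      using szego_projection_sums[OF L2_circle_integrable[OF u] that] by (simp add: f_def power_series_def sums_iff)
    have fb: "boundary_fun f \<in> L2_circle" by (rule hardy_boundary_fun(1)[OF f_hardy f_sums])
    have energy: "energy_form \<omega> u \<kappa> = (LINT w|area_measure. deriv f w * cnj (deriv kz w) * complex_of_real (enn2real (\<omega> w)))"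
      unfolding energy_form_def
      by (rule Bochner_Integration.integral_cong[OF refl])
        (simp add: \<kappa>_def f_def wirtinger_boundary_fun[OF kz_hardy] d_z_poisson_ext[OF u])
    have fz: "f z = L2_inner u S"
      unfolding S_def f_def by (rule szego_projection[OF L2_circle_integrable[OF u] z, symmetric])
    have "kz holomorphic_on unit_disk" using kz by (simp add: dirichlet_space_def)
    then obtain c where c: "\<And>z. norm z < 1 \<Longrightarrow> (\<lambda>n. c n * z ^ n) sums kz z" using holomorphic_taylor by blast
    \<comment> \<open>\<open>u\<close> and the boundary function of its Szego projection have the same Fourier coefficients
      of nonnegative index\<close>
    have "L2_inner (\<lambda>\<zeta>. u \<zeta> - boundary_fun f \<zeta>) \<kappa> = 0"
      unfolding \<kappa>_def
    proof (rule hardy_boundary_fun(4)[OF kz_hardy c])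
      show "(\<lambda>\<zeta>. u \<zeta> - boundary_fun f \<zeta>) \<in> L2_circle" by (rule L2_circle_diff[OF u fb])
      fix n
      have "(\<lambda>\<zeta>. cnj (\<zeta> ^ n)) \<in> L2_circle"
        by (intro L2_circle_continuous continuous_on_cnj continuous_on_power continuous_on_id)
      then have "fourier_coeff (\<lambda>\<zeta>. u \<zeta> - boundary_fun f \<zeta>) n = fourier_coeff u n - fourier_coeff (boundary_fun f) n"
        unfolding fourier_coeff_def left_diff_distrib
        by (intro Bochner_Integration.integral_diff L2_circle_mult_integrable u fb)
      then show "fourier_coeff (\<lambda>\<zeta>. u \<zeta> - boundary_fun f \<zeta>) n = 0"
        using hardy_boundary_fun(2)[OF f_hardy f_sums, of n] by simp
    qed
    moreover have "L2_inner (\<lambda>\<zeta>. u \<zeta> - boundary_fun f \<zeta>) \<kappa> = L2_inner u \<kappa> - L2_inner (boundary_fun f) \<kappa>"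
      unfolding L2_inner_def left_diff_distrib
      by (intro Bochner_Integration.integral_diff L2_circle_mult_integrable L2_circle_cnj u fb \<kappa>)
    ultimately have bd: "L2_inner (boundary_fun f) \<kappa> = L2_inner u \<kappa>" by simp
    have "L2_inner v \<kappa> = energy_form \<omega> u \<kappa>" using G(3)[OF uv \<kappa>_dom] by simp
    also have "\<dots> = f z - L2_inner (boundary_fun f) \<kappa>"
      unfolding energy using repr[OF f] by (simp add: dirichlet_inner_def \<kappa>_def)
    also have "\<dots> = L2_inner u S - L2_inner u \<kappa>" by (simp add: fz bd)
    also have "\<dots> = L2_inner u (\<lambda>\<zeta>. S \<zeta> - \<kappa> \<zeta>)"
      unfolding L2_inner_def complex_cnj_diff right_diff_distrib
      by (intro Bochner_Integration.integral_diff[symmetric] L2_circle_mult_integrable L2_circle_cnj u S \<kappa>)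
    finally show ?thesis .
  qed
  \<comment> \<open>only self-adjointness puts \<open>\<kappa>\<close> into the operator domain; membership in the form domain is weaker\<close>
  then have "(\<kappa>, \<lambda>\<zeta>. S \<zeta> - \<kappa> \<zeta>) \<in> adjoint_graph G"
    using \<kappa> h by (auto simp: adjoint_graph_def)
  then have "(\<kappa>, S) \<in> id_plus G"
    using S unfolding G(2) id_plus_def by (auto simp: L2_eq_def intro!: exI[of _ "\<lambda>\<zeta>. S \<zeta> - \<kappa> \<zeta>"])
  then show ?thesis by (simp add: resolvent_def S_def \<kappa>_def kz_def)
qed

end
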